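(* The universal Weil-Petersson Kähler 2-form $\omega$ and the loop-algebra 2-cocycle $\gamma$ on $ppsl_2$ are related by $$\gamma=-4\,\omega .$$
   Context: $sl_2=sl_2(\mathbb R)$ has basis $e=\begin{pmatrix}0&1\\0&0\end{pmatrix}$, $f=\begin{pmatrix}0&0\\1&0\end{pmatrix}$, $h=\begin{pmatrix}1&0\\0&-1\end{pmatrix}$; the matrix $\begin{pmatrix}\alpha&\beta\\ \gamma&-\alpha\end{pmatrix}$ is identified with the vector field $\{(\gamma+\beta)\cos\theta+2\alpha\sin\theta+(\gamma-\beta)\}\frac{\partial}{\partial\theta}$ on $\mathbb S^1$. The circle is identified with $\hat{\mathbb R}=\mathbb R\cup\{\infty\}$ via $s\mapsto\frac{s-i}{s+i}$, and rational points of $\mathbb S^1$ are the images of $\hat{\mathbb Q}=\mathbb Q\cup\{\infty\}$. $ppsl_2$ is the Lie algebra of piecewise $sl_2$ vector fields on $\mathbb S^1$ with finitely many pieces and rational breakpoints (equivalently, piecewise constant $sl_2$-valued functions with such breakpoints). Farey tesselation: $\mathrm{PSL}_2(\mathbb Z)$ acts on the right on $\mathbb S^1=\hat{\mathbb R}$ by $x.A=\frac{dx-b}{-cx+a}$, $A=\begin{pmatrix}a&b\\c&d\end{pmatrix}$. For $A\in\mathrm{PSL}_2(\mathbb Z)$, $e_A$ is the oriented geodesic from $0.A=-\frac ba$ to $\infty.A=-\frac dc$ in the Poincaré disk $\mathbb D$, and $\tau_*$ is the set of underlying unoriented geodesics, which decompose $\mathbb D$ into ideal triangles. Wavelets: the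 mother wavelet $\vartheta\in ppsl_2$ takes values $h+2e$, $-h+2f$, $-h-2f$, $h-2e$ on quadrants I, II, III, IV respectively. For $A\in\mathrm{PSL}_2(\mathbb Z)$, $\vartheta_A(\theta.A)=A^{-1}\vartheta(\theta)A$; it depends only on the unoriented edge underlying $e_A$. The normalized wavelet is $\bar\vartheta_A=\vartheta_A-X_A$, where $X_A\in sl_2$ is the unique global $sl_2$ vector field agreeing with $\vartheta_A$ at the three points $0,\infty,1$ of $\hat{\mathbb R}\approx\mathbb S^1$. The form $\omega$: $\widetilde{\mathcal{T}ess^n}$ is the space of decorated tesselations of $\mathbb D$ (a locally finite collection of geodesics decomposing $\mathbb D$ into ideal triangles, together with a horocycle centered at each ideal vertex) having $0,1,\infty$ among their ideal vertices. It has coordinates the lambda lengths $\lambda_e>0$ indexed by edges $e\in\tau_*$, where $\lambda=\sqrt{\exp\ell}$ and $\ell$ is the signed hyperbolic distance between the horocycles at the ends of the corresponding edge. The tangent vector $\partial/\partial\log\lambda_e$ at the identity (all lambda lengths equal to one) corresponds to the normalized wavelet $\bar\vartheta_e\in ppsl_2$ of the edge $e$. The (pull-back of the) universal Weil-Petersson Kähler 2-form is $$\omega=-2\sum d\log a\wedge d\log b+d\log b\wedge d\log c+d\log c\wedge d\log a,$$ the sum being over all triangles complementary to $\tau_*$ in $\mathbb D$, each with edges (identified with their lambda lengths) $a,b,c$ in clockwise order, the factor $-2$ multiplying the whole sum. The cocycle $\gamma$: for $\psi^1,\psi^2\in ppsl_2$, $$\gamma(\psi^1,\psi^2)=\frac12\sum_{\theta\in\Pi(\psi^2)}\mathrm{tr}\big\{[\psi^1(\theta^+)+\psi^1(\theta^-)]\,[\psi^2(\theta^+)-\psi^2(\theta^-)]\big\},$$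 where $\Pi(\psi)$ is the finite set of breakpoints of $\psi$, $\theta^{+}$ (resp. $\theta^-$) denotes a point slightly beyond (resp. before) $\theta$ in the counter-clockwise orientation, and values are taken as $2\times2$ matrices. (This is the form on $ppsl_2$ of the loop-algebra cocycle $\frac1{2\pi}\int_0^{2\pi}\mathrm{tr}(\psi^1\,d\psi^2)$.) *)

theory Defs
  imports "HOL-Analysis.Analysis"
begin

section \<open>The circle and the action of the modular group\<close>

datatype hat_real = Fin real | Infty

fun cayley :: "hat_real \<Rightarrow> complex" where
  "cayley (Fin s) = (of_real s - \<i>) / (of_real s + \<i>)"
| "cayley Infty = 1"

definition hat_rat :: "hat_real set" where
  "hat_rat = insert Infty (Fin ` \<rat>)"

abbreviation circle :: "complex set" where
  "circle \<equiv> sphere 0 1"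

definition mat2 :: "real \<Rightarrow> real \<Rightarrow> real \<Rightarrow> real \<Rightarrow> real^2^2" where
  "mat2 a b c d = vector [vector [a, b], vector [c, d]]"

text \<open>Elements of PSL(2,Z) are represented by either of their two lifts to SL(2,Z);
  everything below is unchanged under \<open>A \<mapsto> - A\<close>.\<close>

definition SL2Z :: "(real^2^2) set" where
  "SL2Z = {A. (\<forall>i j. A $ i $ j \<in> \<int>) \<and> det A = 1}"

text \<open>The right action \<open>x.A = (d x - b) / (- c x + a)\<close>.\<close>

fun act :: "hat_real \<Rightarrow> real^2^2 \<Rightarrow> hat_real" where
  "act (Fin x) A =
     (if - (A$2$1) * x + A$1$1 = 0 then Infty
      else Fin ((A$2$2 * x - A$1$2) / (- (A$2$1) * x + A$1$1)))"
| "act Infty A = (if A$2$1 = 0 then Infty else Fin (- (A$2$2) / A$2$1))"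

definition circle_act :: "complex \<Rightarrow> real^2^2 \<Rightarrow> complex" where
  "circle_act z A = cayley (act (inv cayley z) A)"


section \<open>The Farey tesselation\<close>

text \<open>The map from the Poincare disk to the Klein disk that fixes the ideal boundary and carries
  hyperbolic geodesics to straight chords.\<close>

definition klein :: "complex \<Rightarrow> complex" where
  "klein z = (2 / (1 + (norm z)\<^sup>2)) *\<^sub>R z"

definition geodesic :: "complex \<Rightarrow> complex \<Rightarrow> complex set" where
  "geodesic p q = {z \<in> ball 0 1. klein z \<in> open_segment p q}"

definition ideal_triangle :: "complex \<Rightarrow> complex \<Rightarrow> complex \<Rightarrow> complex set" where
  "ideal_triangle p q r = {z \<in> ball 0 1. klein z \<in> interior (convex hull {p, q, r})}"

definition edge :: "real^2^2 \<Rightarrow> complex set" where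
  "edge A = geodesic (cayley (act (Fin 0) A)) (cayley (act Infty A))"

definition farey :: "complex set set" where
  "farey = edge ` SL2Z"

definition clockwise :: "complex \<Rightarrow> complex \<Rightarrow> complex \<Rightarrow> bool" where
  "clockwise p q r \<longleftrightarrow> p \<in> circle \<and> q \<in> circle \<and> r \<in> circle \<and> Im (cnj (q - p) * (r - p)) < 0"

definition has_clockwise_edges ::
    "complex set \<Rightarrow> complex set \<times> complex set \<times> complex set \<Rightarrow> bool" where
  "has_clockwise_edges T abc \<longleftrightarrow>
     (\<exists>p q r. clockwise p q r \<and> T = ideal_triangle p q r \<and>
        abc = (geodesic p q, geodesic q r, geodesic r p))"

definition farey_triangles :: "complex set set" where
  "farey_triangles =
     {T \<in> components (ball 0 1 - \<Union>farey).
        \<exists>a\<in>farey. \<exists>b\<in>farey. \<exists>c\<in>farey. has_clockwise_edges T (a, b, c)}"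

text \<open>Determined up to cyclic permutation, under which the summand of \<open>\<omega>\<close> is invariant.\<close>

definition clockwise_edges :: "complex set \<Rightarrow> complex set \<times> complex set \<times> complex set" where
  "clockwise_edges T = (SOME abc. has_clockwise_edges T abc)"


section \<open>The Weil-Petersson form in log lambda lengths\<close>

text \<open>A function \<open>u\<close> on edges stands for the tangent vector
  \<open>\<Sum>e. u e \<cdot> \<partial>/\<partial> log \<lambda>\<^sub>e\<close> at the point where all lambda lengths are one.\<close>

type_synonym tangent = "complex set \<Rightarrow> real"

definition dlog :: "complex set \<Rightarrow> tangent \<Rightarrow> real" where
  "dlog e u = u e"

text \<open>The wedge product of 1-forms is the antisymmetrization of their tensor product,
  with the factor \<open>1/2\<close> (the convention of Kobayashi and Nomizu). The convention matters: without
  the factor \<open>1/2\<close> the form \<open>\<omega>\<close> below would be twice as large.\<close>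

definition wedge :: "('v \<Rightarrow> real) \<Rightarrow> ('v \<Rightarrow> real) \<Rightarrow> 'v \<Rightarrow> 'v \<Rightarrow> real" where
  "wedge \<phi> \<psi> u v = (\<phi> u * \<psi> v - \<phi> v * \<psi> u) / 2"

text \<open>The sum runs over infinitely many triangles, but for finitely supported \<open>u\<close> and \<open>v\<close>
  only finitely many summands are nonzero.\<close>

definition wp_form :: "tangent \<Rightarrow> tangent \<Rightarrow> real" where
  "wp_form u v =
     - 2 * (\<Sum>\<^sub>\<infinity>T\<in>farey_triangles.
              case clockwise_edges T of (a, b, c) \<Rightarrow>
                wedge (dlog a) (dlog b) u v + wedge (dlog b) (dlog c) u v
                  + wedge (dlog c) (dlog a) u v)"


section \<open>Piecewise sl(2) vector fields and the cocycle\<close>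

text \<open>Values at the breakpoints themselves are immaterial: elements which agree off a finite set
  represent the same vector field. The cocycle below only sees one-sided limits.\<close>

definition ppsl2 :: "(complex \<Rightarrow> real^2^2) set" where
  "ppsl2 = {\<psi>. (\<forall>z\<in>circle. trace (\<psi> z) = 0) \<and>
     (\<exists>F. finite F \<and> F \<subseteq> cayley ` hat_rat \<and>
        (\<forall>C\<in>components (circle - F). \<psi> constant_on C))}"

definition value_beyond :: "(complex \<Rightarrow> real^2^2) \<Rightarrow> complex \<Rightarrow> real^2^2" where
  "value_beyond \<psi> z = Lim (at_right (Arg z)) (\<lambda>t. \<psi> (cis t))"

definition value_before :: "(complex \<Rightarrow> real^2^2) \<Rightarrow> complex \<Rightarrow> real^2^2" where
  "value_before \<psi> z = Lim (at_left (Arg z)) (\<lambda>t. \<psi> (cis t))"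

definition breakpoints :: "(complex \<Rightarrow> real^2^2) \<Rightarrow> complex set" where
  "breakpoints \<psi> = {z \<in> circle. value_beyond \<psi> z \<noteq> value_before \<psi> z}"

definition cocycle :: "(complex \<Rightarrow> real^2^2) \<Rightarrow> (complex \<Rightarrow> real^2^2) \<Rightarrow> real" where
  "cocycle \<psi>1 \<psi>2 =
     1/2 * (\<Sum>z\<in>breakpoints \<psi>2.
              trace ((value_beyond \<psi>1 z + value_before \<psi>1 z) **
                     (value_beyond \<psi>2 z - value_before \<psi>2 z)))"


section \<open>Wavelets\<close>

definition sl2_e :: "real^2^2" where "sl2_e = mat2 0 1 0 0"
definition sl2_f :: "real^2^2" where "sl2_f = mat2 0 0 1 0"
definition sl2_h :: "real^2^2" where "sl2_h = mat2 1 0 0 (-1)"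

text \<open>Each quadrant contains its initial endpoint in the counter-clockwise orientation.\<close>

definition mother :: "complex \<Rightarrow> real^2^2" where
  "mother z =
     (if Re z > 0 \<and> Im z \<ge> 0 then sl2_h + 2 *\<^sub>R sl2_e
      else if Re z \<le> 0 \<and> Im z > 0 then - sl2_h + 2 *\<^sub>R sl2_f
      else if Re z < 0 \<and> Im z \<le> 0 then - sl2_h - 2 *\<^sub>R sl2_f
      else sl2_h - 2 *\<^sub>R sl2_e)"

text \<open>This solves \<open>wavelet A (\<theta>.A) = A\<^sup>-\<^sup>1 mother(\<theta>) A\<close>.\<close>

definition wavelet :: "real^2^2 \<Rightarrow> complex \<Rightarrow> real^2^2" where
  "wavelet A z = matrix_inv A ** mother (circle_act z (matrix_inv A)) ** A"

text \<open>The coefficient of \<open>\<partial>/\<partial>\<theta>\<close> at \<open>z = cos \<theta> + \<i> sin \<theta>\<close> of the vector field of \<open>X\<close>.\<close>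

definition vec_field :: "real^2^2 \<Rightarrow> complex \<Rightarrow> real" where
  "vec_field X z = (X$2$1 + X$1$2) * Re z + 2 * X$1$1 * Im z + (X$2$1 - X$1$2)"

text \<open>As a vector field each wavelet is continuous, so its value at the three normalization points
  does not depend on the choice of matrix at a breakpoint.\<close>

definition normalizer :: "real^2^2 \<Rightarrow> real^2^2" where
  "normalizer A = (THE X. trace X = 0 \<and>
     (\<forall>p \<in> cayley ` {Fin 0, Infty, Fin 1}. vec_field X p = vec_field (wavelet A p) p))"

definition normalized_wavelet :: "real^2^2 \<Rightarrow> complex \<Rightarrow> real^2^2" where
  "normalized_wavelet A z = wavelet A z - normalizer A"

text \<open>The wavelet depends only on the unoriented edge, so that the choice of \<open>A\<close> is immaterial.\<close>

definition edge_wavelet :: "complex set \<Rightarrow> complex \<Rightarrow> real^2^2" where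
  "edge_wavelet e = normalized_wavelet (SOME A. A \<in> SL2Z \<and> edge A = e)"

text \<open>The identification of \<open>\<partial>/\<partial> log \<lambda>\<^sub>e\<close> with the normalized wavelet of \<open>e\<close>,
  extended linearly.\<close>

definition tangent_field :: "tangent \<Rightarrow> complex \<Rightarrow> real^2^2" where
  "tangent_field u z = (\<Sum>e\<in>{e. u e \<noteq> 0}. u e *\<^sub>R edge_wavelet e z)"


section \<open>Tangent fields are piecewise sl(2)\<close>

lemma mat2_nth [simp]:
  "mat2 a b c d $ 1 $ 1 = a" "mat2 a b c d $ 1 $ 2 = b"
  "mat2 a b c d $ 2 $ 1 = c" "mat2 a b c d $ 2 $ 2 = d"
  by (simp_all add: mat2_def)

lemma trace_2: "trace (X :: real^2^2) = X$1$1 + X$2$2"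
  by (simp add: trace_def sum_2)

lemma
  assumes "A \<in> SL2Z"
  shows matrix_inv_SL2Z: "matrix_inv A = mat2 (A$2$2) (- A$1$2) (- A$2$1) (A$1$1)"
    and matrix_inv_mult_SL2Z: "A ** matrix_inv A = mat 1"
    and matrix_inv_in_SL2Z: "matrix_inv A \<in> SL2Z"
proof -
  let ?B = "mat2 (A$2$2) (- A$1$2) (- A$2$1) (A$1$1)"
  have d: "A$1$1 * A$2$2 - A$1$2 * A$2$1 = 1"
    using assms by (simp add: SL2Z_def det_2)
  have AB: "A ** ?B = mat 1"
    using d by (simp add: vec_eq_iff forall_2 matrix_matrix_mult_def sum_2 mat_def mult.commute)
  have BA: "?B ** A = mat 1"
    using AB by (rule matrix_left_right_inverse[THEN iffD1])
  show eq: "matrix_inv A = ?B"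
    unfolding matrix_inv_def
  proof (rule some_equality)
    show "A ** ?B = mat 1 \<and> ?B ** A = mat 1"
      using AB BA by blast
    show "B = ?B" if "A ** B = mat 1 \<and> B ** A = mat 1" for B
      by (metis AB that matrix_mul_assoc matrix_mul_lid matrix_mul_rid)
  qed
  show "A ** matrix_inv A = mat 1"
    using AB eq by simp
  show "matrix_inv A \<in> SL2Z"
    using assms d by (auto simp: eq SL2Z_def det_2 forall_2 mult.commute)
qed

lemma cayley_in_circle: "cayley x \<in> circle"
proof (cases x)
  case (Fin s)
  have "norm (of_real s - \<i>) = norm (of_real s + \<i>)"
    by (simp add: cmod_def)
  moreover have "of_real s + \<i> \<noteq> 0"
    by (auto simp: complex_eq_iff)
  ultimately show ?thesis
    using Fin by (simp add: norm_divide)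
qed simp

lemma of_real_plus_i_nz [simp]: "of_real s + \<i> \<noteq> 0"
  by (auto simp: complex_eq_iff)

lemma inj_cayley: "inj cayley"
proof (rule injI)
  fix x y assume eq: "cayley x = cayley y"
  have ne: "cayley (Fin s) \<noteq> 1" for s
    by (simp add: divide_eq_1_iff)
  have "s = t" if "cayley (Fin s) = cayley (Fin t)" for s t
    using that by (simp add: frac_eq_eq) (simp add: complex_eq_iff)
  with eq ne show "x = y"
    by (metis cayley.simps(2) hat_real.exhaust)
qed

definition uncayley :: "complex \<Rightarrow> real" where
  "uncayley z = Re (\<i> * (1 + z) / (1 - z))"

lemma uncayley:
  assumes "z \<in> circle" "z \<noteq> 1"
  shows "of_real (uncayley z) = \<i> * (1 + z) / (1 - z)" "cayley (Fin (uncayley z)) = z"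
proof -
  let ?w = "\<i> * (1 + z) / (1 - z)"
  have z: "z * cnj z = 1"
    using assms by (simp add: complex_norm_square[symmetric])
  have nz: "1 - z \<noteq> 0" "1 - cnj z \<noteq> 0"
    using assms(2) by (metis complex_cnj_one complex_cnj_cancel_iff right_minus_eq)+
  have "cnj ?w = - \<i> * (1 + cnj z) / (1 - cnj z)"
    by simp
  also have "\<dots> = ?w"
    by (subst frac_eq_eq[OF nz(2,1)]) (use z in \<open>simp add: algebra_simps\<close>)
  finally have "cnj ?w = ?w" .
  then have "Im ?w = 0"
    by (metis Im_complex_of_real Reals_cases Reals_cnj_iff)
  then show *: "of_real (uncayley z) = ?w"
    unfolding uncayley_def by (simp only: complex_eq_iff Re_complex_of_real Im_complex_of_real)
  show "cayley (Fin (uncayley z)) = z"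
    using assms(2) by (simp add: * divide_simps) (simp add: algebra_simps)
qed

lemma inv_cayley:
  assumes "z \<in> circle"
  shows "inv cayley z = (if z = 1 then Infty else Fin (uncayley z))" "cayley (inv cayley z) = z"
proof -
  show "inv cayley z = (if z = 1 then Infty else Fin (uncayley z))"
    using inv_f_f[OF inj_cayley, of Infty] inv_f_f[OF inj_cayley, of "Fin (uncayley z)"]
      uncayley(2)[OF assms] by auto
  then show "cayley (inv cayley z) = z"
    using uncayley(2)[OF assms] by auto
qed

lemma act_matrix_inv:
  assumes "A \<in> SL2Z"
  shows "act (act x (matrix_inv A)) A = x"
proof -
  obtain a b c d where abcd: "A$1$1 = a" "A$1$2 = b" "A$2$1 = c" "A$2$2 = d"
    by blast
  have det: "a * d - b * c = 1"
    using assms abcd by (simp add: SL2Z_def det_2)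
  show ?thesis
  proof (cases x)
    case Infty
    show ?thesis
    proof (cases "c = 0")
      case True
      then show ?thesis
        using Infty by (simp add: matrix_inv_SL2Z[OF assms] abcd)
    next
      case False
      then show ?thesis
        using Infty by (simp add: matrix_inv_SL2Z[OF assms] abcd)
    qed
  next
    case (Fin s)
    show ?thesis
    proof (cases "c * s + d = 0")
      case True
      then have "c \<noteq> 0"
        using det by auto
      moreover have "s = - d / c"
        using True \<open>c \<noteq> 0\<close> by (simp add: field_simps)
      ultimately show ?thesis
        using Fin True by (simp add: matrix_inv_SL2Z[OF assms] abcd)
    next
      case False
      have 1: "- c * ((a * s + b) / (c * s + d)) + a = 1 / (c * s + d)"
        using det False by (simp add: field_simps)
      have 2: "d * ((a * s + b) / (c * s + d)) - b = s / (c * s + d)"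
      proof -
        have "d * (a * s + b) - b * (c * s + d) = s * (a * d - b * c)"
          by (simp add: algebra_simps)
        then show ?thesis
          using False by (simp add: det divide_simps)
      qed
      show ?thesis
      proof -
        have "act x (matrix_inv A) = Fin ((a * s + b) / (c * s + d))"
          using Fin False by (simp add: matrix_inv_SL2Z[OF assms] abcd)
        moreover have "act (Fin ((a * s + b) / (c * s + d))) A = Fin s"
          unfolding act.simps abcd 1 2 using False by simp
        ultimately show ?thesis
          using Fin by simp
      qed
    qed
  qed
qed

lemma act_hat_rat:
  assumes "A \<in> SL2Z" "x \<in> hat_rat"
  shows "act x A \<in> hat_rat"
proof -
  have "A $ i $ j \<in> \<rat>" for i j
    using assms(1) Ints_subset_Rats by (auto simp: SL2Z_def)
  then show ?thesis
    using assms(2) by (cases x) (auto simp: hat_rat_def split: if_splits)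
qed

lemma continuous_on_circle_act:
  assumes "A \<in> SL2Z"
  shows "continuous_on circle (\<lambda>z. circle_act z A)"
proof -
  obtain a b c d where abcd: "A$1$1 = a" "A$1$2 = b" "A$2$1 = c" "A$2$2 = d"
    by blast
  have det: "a * d - b * c = 1"
    using assms abcd by (simp add: SL2Z_def det_2)
  define p :: complex where "p = d + \<i> * c"
  define q :: complex where "q = b + \<i> * a"
  define m where "m z = \<i> * (1 + z) * cnj p - (1 - z) * cnj q" for z
  define n where "n z = \<i> * (1 + z) * p - (1 - z) * q" for z
  have p: "p \<noteq> 0"
    using det by (auto simp: p_def complex_eq_iff)
  have fin: "cayley (act (Fin x) A) = (of_real x * p - q) / (of_real x * cnj p - cnj q)"
    and nz: "of_real x * cnj p - cnj q \<noteq> 0" for x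
  proof -
    show nz: "of_real x * cnj p - cnj q \<noteq> 0"
    proof
      assume "of_real x * cnj p - cnj q = 0"
      then have "x * d = b" "x * c = a"
        by (auto simp: complex_eq_iff p_def q_def)
      then have "a * d - b * c = 0"
        by (simp add: mult.assoc mult.commute mult.left_commute flip: \<open>x * d = b\<close> \<open>x * c = a\<close>)
      with det show False by simp
    qed
    show "cayley (act (Fin x) A) = (of_real x * p - q) / (of_real x * cnj p - cnj q)"
    proof (cases "- c * x + a = 0")
      case True
      then have "of_real x * p - q = of_real x * cnj p - cnj q"
        by (simp add: complex_eq_iff p_def q_def algebra_simps)
      then show ?thesis
        using True nz by (simp add: abcd)
    next
      case False
      let ?k = "complex_of_real (- c * x + a)"
      have k: "?k \<noteq> 0"
        using False by (simp only: of_real_eq_0_iff not_False_eq_True)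
      have "cayley (act (Fin x) A)
          = ((d * x - b) / ?k - \<i>) / ((d * x - b) / ?k + \<i>)"
        using False by (simp add: abcd)
      also have "\<dots> = ((d * x - b) - \<i> * ?k) / ((d * x - b) + \<i> * ?k)"
        using k by (simp add: divide_simps del: of_real_add of_real_mult of_real_minus)
      also have "\<dots> = (of_real x * p - q) / (of_real x * cnj p - cnj q)"
        by (simp add: p_def q_def algebra_simps)
      finally show ?thesis .
    qed
  qed
  have eq: "circle_act z A = n z / m z" and m: "m z \<noteq> 0" if z: "z \<in> circle" for z
  proof -
    have "circle_act z A = n z / m z \<and> m z \<noteq> 0"
    proof (cases "z = 1")
      case True
      have "cayley (act Infty A) = p / cnj p"
      proof (cases "c = 0")
        case True
        then show ?thesis using p by (simp add: abcd p_def)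
      next
        case False
        have "cayley (act Infty A) = (- d / c - \<i>) / (- d / c + \<i>)"
          using False by (simp add: abcd)
        also have "\<dots> = (- d - \<i> * c) / (- d + \<i> * c)"
          using False by (simp add: divide_simps)
        also have "\<dots> = (- p) / (- cnj p)"
          by (simp add: p_def)
        finally show ?thesis by simp
      qed
      then show ?thesis
        using True p inv_cayley(1)[OF z] by (simp add: circle_act_def m_def n_def)
    next
      case False
      let ?x = "uncayley z"
      have x: "(1 - z) * of_real ?x = \<i> * (1 + z)"
        using uncayley(1)[OF z False] False by simp
      have "m z = (1 - z) * (of_real ?x * cnj p - cnj q)" "n z = (1 - z) * (of_real ?x * p - q)"
        unfolding m_def n_def x[symmetric] by (simp_all add: algebra_simps)
      then show ?thesis
        using False nz[of ?x] fin[of ?x] inv_cayley(1)[OF z] by (simp add: circle_act_def)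
    qed
    then show "circle_act z A = n z / m z" "m z \<noteq> 0" by auto
  qed
  have "continuous_on circle (\<lambda>z. n z / m z)"
    using m unfolding n_def m_def by (intro continuous_intros) auto
  then show ?thesis
    using eq continuous_on_cong[OF refl, of circle "\<lambda>z. circle_act z A" "\<lambda>z. n z / m z"]
    by blast
qed

lemma connected_same_sgn:
  fixes f :: "complex \<Rightarrow> real"
  assumes "connected C" "continuous_on C f" "0 \<notin> f ` C" "x \<in> C" "y \<in> C"
  shows "f x > 0 \<longleftrightarrow> f y > 0" "f x < 0 \<longleftrightarrow> f y < 0"
proof -
  have "connected (f ` C)"
    using assms by (intro connected_continuous_image)
  then have *: "\<not> (f a < 0 \<and> 0 < f b)" if "a \<in> C" "b \<in> C" for a b
    using connectedD_interval[of "f ` C" "f a" "f b" 0] that assms(3) by auto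
  have "f x \<noteq> 0" "f y \<noteq> 0"
    using assms by (metis imageI)+
  then show "f x > 0 \<longleftrightarrow> f y > 0" "f x < 0 \<longleftrightarrow> f y < 0"
    using *[of x y] *[of y x] assms by linarith+
qed

lemma mother_constant_on:
  assumes "connected C" "C \<subseteq> circle - {1, \<i>, -1, -\<i>}"
  shows "mother constant_on C"
proof -
  have nz: "Re z \<noteq> 0 \<and> Im z \<noteq> 0" if "z \<in> C" for z
  proof -
    have "(Re z)\<^sup>2 + (Im z)\<^sup>2 = 1" "z \<notin> {1, \<i>, -1, -\<i>}"
      using that assms(2) by (auto simp: cmod_def)
    then show ?thesis
      by (auto simp: complex_eq_iff power2_eq_1_iff)
  qed
  have "mother x = mother y" if "x \<in> C" "y \<in> C" for x y
  proof -
    have R: "Re x > 0 \<longleftrightarrow> Re y > 0" "Re x < 0 \<longleftrightarrow> Re y < 0"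
      by (rule connected_same_sgn[of C]; use assms(1) nz that in \<open>force intro!: continuous_intros\<close>)+
    have I: "Im x > 0 \<longleftrightarrow> Im y > 0" "Im x < 0 \<longleftrightarrow> Im y < 0"
      by (rule connected_same_sgn[of C]; use assms(1) nz that in \<open>force intro!: continuous_intros\<close>)+
    show ?thesis
      using R I nz[OF that(1)] nz[OF that(2)] unfolding mother_def by (auto simp: not_less)
  qed
  then show ?thesis
    unfolding constant_on_def by metis
qed

lemma trace_mother: "trace (mother z) = 0"
  by (simp add: mother_def trace_2 sl2_e_def sl2_f_def sl2_h_def)

lemma ppsl2_iff_connected:
  "\<psi> \<in> ppsl2 \<longleftrightarrow> (\<forall>z\<in>circle. trace (\<psi> z) = 0) \<and>
     (\<exists>F. finite F \<and> F \<subseteq> cayley ` hat_rat \<and>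
        (\<forall>C. connected C \<and> C \<subseteq> circle - F \<longrightarrow> \<psi> constant_on C))"
proof -
  have "(\<forall>C\<in>components (circle - F). \<psi> constant_on C) \<longleftrightarrow>
      (\<forall>C. connected C \<and> C \<subseteq> circle - F \<longrightarrow> \<psi> constant_on C)" for F
  proof (intro iffI ballI allI impI)
    fix C assume *: "\<forall>C\<in>components (circle - F). \<psi> constant_on C"
      and C: "connected C \<and> C \<subseteq> circle - F"
    show "\<psi> constant_on C"
    proof (cases "circle - F = {}")
      case True
      then show ?thesis using C by (auto simp: constant_on_def)
    next
      case False
      then obtain D where "D \<in> components (circle - F)" "C \<subseteq> D"
        using exists_component_superset[of C "circle - F"] C by blast
      then show ?thesis
        using * constant_on_subset by blast
    qed
  next
    fix C assume "\<forall>C. connected C \<and> C \<subseteq> circle - F \<longrightarrow> \<psi> constant_on C"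
      and "C \<in> components (circle - F)"
    then show "\<psi> constant_on C"
      using in_components_connected in_components_subset by blast
  qed
  then show ?thesis
    by (simp add: ppsl2_def)
qed

lemma wavelet_in_ppsl2:
  assumes "A \<in> SL2Z"
  shows "wavelet A \<in> ppsl2"
proof -
  let ?B = "matrix_inv A"
  have B: "?B \<in> SL2Z"
    using assms by (rule matrix_inv_in_SL2Z)
  define F where "F = (\<lambda>x. cayley (act x A)) ` {Fin 0, Infty, Fin 1, Fin (-1)}"
  have tr: "trace (wavelet A z) = 0" for z
  proof -
    have "trace (wavelet A z) = trace (A ** (?B ** mother (circle_act z ?B)))"
      unfolding wavelet_def by (rule trace_mul_sym)
    also have "\<dots> = 0"
      by (simp add: matrix_mul_assoc matrix_inv_mult_SL2Z[OF assms] trace_mother)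
    finally show ?thesis .
  qed
  have "act x A \<in> hat_rat" if "x \<in> {Fin 0, Infty, Fin 1, Fin (-1)}" for x
    by (rule act_hat_rat[OF assms]) (use that in \<open>auto simp: hat_rat_def\<close>)
  then have F: "finite F" "F \<subseteq> cayley ` hat_rat"
    unfolding F_def by blast+
  have "wavelet A constant_on C" if C: "connected C" "C \<subseteq> circle - F" for C
  proof -
    let ?D = "(\<lambda>z. circle_act z ?B) ` C"
    have "connected ?D"
      using C continuous_on_subset[OF continuous_on_circle_act[OF B], of C]
      by (intro connected_continuous_image) auto
    moreover have "?D \<subseteq> circle - {1, \<i>, -1, -\<i>}"
    proof
      fix w assume "w \<in> ?D"
      then obtain z where z: "z \<in> C" "w = cayley (act (inv cayley z) ?B)"
        by (auto simp: circle_act_def)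
      have "w \<notin> {1, \<i>, -1, -\<i>}"
      proof
        assume "w \<in> {1, \<i>, -1, -\<i>}"
        also have "{1, \<i>, -1, -\<i>} = cayley ` {Fin 0, Infty, Fin 1, Fin (-1)}"
          by (auto simp: complex_eq_iff Re_divide Im_divide power2_eq_square)
        finally have "act (inv cayley z) ?B \<in> {Fin 0, Infty, Fin 1, Fin (-1)}"
          unfolding z(2) by (simp only: inj_image_mem_iff[OF inj_cayley])
        then have "cayley (act (act (inv cayley z) ?B) A) \<in> F"
          unfolding F_def by blast
        then have "z \<in> F"
          using act_matrix_inv[OF assms] inv_cayley(2)[of z] z C by auto
        then show False
          using z C by blast
      qed
      then show "w \<in> circle - {1, \<i>, -1, -\<i>}"
        using cayley_in_circle z(2) by blast
    qed
    ultimately have "mother constant_on ?D"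
      by (rule mother_constant_on)
    then show ?thesis
      unfolding constant_on_def wavelet_def by (metis imageI)
  qed
  then show ?thesis
    using tr F unfolding ppsl2_iff_connected by blast
qed

lemma const_in_ppsl2: "trace X = 0 \<Longrightarrow> (\<lambda>z. X) \<in> ppsl2"
  by (auto simp: ppsl2_def constant_on_def intro!: exI[of _ "{}"])

lemma add_in_ppsl2:
  assumes "\<phi> \<in> ppsl2" "\<psi> \<in> ppsl2"
  shows "(\<lambda>z. \<phi> z + \<psi> z) \<in> ppsl2"
proof -
  obtain F where F: "finite F" "F \<subseteq> cayley ` hat_rat"
      "\<And>C. connected C \<Longrightarrow> C \<subseteq> circle - F \<Longrightarrow> \<phi> constant_on C"
    using assms(1) unfolding ppsl2_iff_connected by blast
  obtain G where G: "finite G" "G \<subseteq> cayley ` hat_rat"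
      "\<And>C. connected C \<Longrightarrow> C \<subseteq> circle - G \<Longrightarrow> \<psi> constant_on C"
    using assms(2) unfolding ppsl2_iff_connected by blast
  have "(\<lambda>z. \<phi> z + \<psi> z) constant_on C" if "connected C" "C \<subseteq> circle - (F \<union> G)" for C
  proof -
    have "\<phi> constant_on C" "\<psi> constant_on C"
      using F(3)[of C] G(3)[of C] that by auto
    then show ?thesis
      unfolding constant_on_def by metis
  qed
  moreover have "finite (F \<union> G)" "F \<union> G \<subseteq> cayley ` hat_rat"
    using F G by auto
  moreover have "\<forall>z\<in>circle. trace (\<phi> z + \<psi> z) = 0"
    using assms by (simp add: ppsl2_def trace_add)
  ultimately show ?thesis
    unfolding ppsl2_iff_connected by blast
qed

lemma scaleR_in_ppsl2:
  assumes "\<psi> \<in> ppsl2"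
  shows "(\<lambda>z. k *\<^sub>R \<psi> z) \<in> ppsl2"
proof -
  obtain F where F: "finite F" "F \<subseteq> cayley ` hat_rat" "\<forall>C\<in>components (circle - F). \<psi> constant_on C"
    and tr: "\<forall>z\<in>circle. trace (\<psi> z) = 0"
    using assms unfolding ppsl2_def by blast
  have "\<forall>C\<in>components (circle - F). (\<lambda>z. k *\<^sub>R \<psi> z) constant_on C"
    using F(3) unfolding constant_on_def by metis
  moreover have "\<forall>z\<in>circle. trace (k *\<^sub>R \<psi> z) = 0"
    using tr by (simp add: trace_2 flip: distrib_left)
  ultimately show ?thesis
    using F(1,2) unfolding ppsl2_def by blast
qed

lemma trace_normalizer: "trace (normalizer A) = 0"
proof -
  have pts: "cayley (Fin 0) = -1" "cayley (Fin 1) = -\<i>"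
    by (auto simp: complex_eq_iff Re_divide Im_divide power2_eq_square)
  define v where "v p = vec_field (wavelet A p) p" for p
  let ?P = "\<lambda>X :: real^2^2. trace X = 0 \<and>
      (\<forall>p \<in> cayley ` {Fin 0, Infty, Fin 1}. vec_field X p = v p)"
  let ?b = "- v (-1) / 2" and ?c = "v 1 / 2"
  let ?a = "(?c - ?b - v (-\<i>)) / 2"
  have iff: "?P X \<longleftrightarrow> X = mat2 ?a ?b ?c (- ?a)" for X
    by (auto simp: vec_eq_iff forall_2 trace_2 pts vec_field_def field_simps simp del: cayley.simps(1))
  have "?P (THE X. ?P X)"
    by (rule theI'[of ?P]) (simp only: iff, blast)
  then show ?thesis
    by (simp add: normalizer_def v_def)
qed

lemma edge_wavelet_in_ppsl2:
  assumes "e \<in> farey"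
  shows "edge_wavelet e \<in> ppsl2"
proof -
  define A where "A = (SOME A. A \<in> SL2Z \<and> edge A = e)"
  have "A \<in> SL2Z"
    unfolding A_def using assms by (rule_tac someI2_ex) (auto simp: farey_def)
  then have "(\<lambda>z. wavelet A z + - normalizer A) \<in> ppsl2"
    using trace_normalizer[of A]
    by (intro add_in_ppsl2 wavelet_in_ppsl2 const_in_ppsl2) (auto simp: trace_2)
  also have "(\<lambda>z. wavelet A z + - normalizer A) = edge_wavelet e"
    by (auto simp: edge_wavelet_def A_def normalized_wavelet_def)
  finally show ?thesis .
qed

lemma tangent_field_in_ppsl2:
  assumes "finite {e. u e \<noteq> 0}" "{e. u e \<noteq> 0} \<subseteq> farey"
  shows "tangent_field u \<in> ppsl2"
proof -
  have "(\<lambda>z. \<Sum>e\<in>S. u e *\<^sub>R edge_wavelet e z) \<in> ppsl2" if "finite S" "S \<subseteq> farey" for S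
    using that
  proof (induction S rule: finite_induct)
    case empty
    then show ?case by (simp add: const_in_ppsl2 trace_2)
  next
    case (insert e S)
    then show ?case
      by (auto intro!: add_in_ppsl2 scaleR_in_ppsl2 edge_wavelet_in_ppsl2)
  qed
  from this[OF assms] show ?thesis
    by (simp add: tangent_field_def[abs_def])
qed

end

theory Submission
  imports Defs
begin

text \<open>
Both sides are bilinear, and both turn out to be the same combinatorial expression in the
coefficients of the two tangent vectors. An edge \<open>e\<close> of the Farey tesselation is a diagonal of
the quadrilateral formed by its two adjacent triangles. Let \<open>n\<^sub>1\<close> and \<open>n\<^sub>3\<close> be the edges that follow \<open>e\<close>,
and let \<open>n\<^sub>2\<close> and \<open>n\<^sub>4\<close> be those that precede \<open>e\<close>, in the clockwise order of these triangles. Then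
the common value is \<open>4 * (\<Sum>e. u e * (v n\<^sub>1 - v n\<^sub>2 + v n\<^sub>3 - v n\<^sub>4))\<close>.

For \<open>\<omega>\<close> this is a regrouping of the sum. In a triangle with clockwise edges \<open>a, b, c\<close> the summand
is half of \<open>u a * (v b - v c) + u b * (v c - v a) + u c * (v a - v b)\<close>, so each edge \<open>e\<close> collects
one difference of neighbours from each triangle that has \<open>e\<close> as a side. There are exactly two of
these: vertices are represented by primitive integer vectors, edges join vectors of determinant
\<open>\<plusminus>1\<close>, and a vertex joined to both ends \<open>p, q\<close> of an edge is \<open>p + q\<close> or \<open>p - q\<close>. That the ideal
triangles spanned by such vectors really are complementary regions of the tesselation amounts to
the fact that Farey edges do not cross (\<open>farey_noncrossing\<close>), combined with a connectedness
argument in the Klein model, where geodesics are chords (\<open>ideal_triangle_component\<close>).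

For \<open>\<gamma>\<close> the point is that a wavelet is continuous as a vector field, so its jump at a breakpoint
with primitive coordinate vector \<open>w\<close> is a multiple of the parabolic matrix \<open>w w\<^sup>T J\<close>, where \<open>J\<close> is the
standard symplectic matrix. The multiple is \<open>4\<close> at the ends of the edge and \<open>-2\<close> at the two
opposite vertices (\<open>wavelet_one_sided\<close>). The trace of a matrix \<open>X\<close> against \<open>w w\<^sup>T J\<close> is, up to
normalization, the value at \<open>w\<close> of the vector field of \<open>X\<close>, a quadratic form in \<open>w\<close>. Hence, for two edges, the cocycle
is \<open>4 Q(p) + 4 Q(q) - 2 Q(p + q) - 2 Q(p - q)\<close>, where \<open>p, q\<close> are the ends of the second edge and
\<open>Q\<close> is the vector field of the first wavelet in this normalization. This \<open>Q\<close> is a quadratic form on each of the four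
cones cut out by the quadrilateral of the first edge, and by the parallelogram law the expression
vanishes as soon as all four vectors lie in one cone. The remaining second edges are the first
edge itself, where \<open>Q\<close> is zero at all four points, and the four sides of its quadrilateral, which
give \<open>\<plusminus>4\<close> (\<open>value_defect_eq_side_sign\<close>). The parallelogram law for \<open>w w\<^sup>T J\<close> also shows that the
jumps of a wavelet add up to zero, so the constant normalizations do not contribute.
\<close>

section \<open>Homogeneous coordinates on the circle\<close>

definition cross2 :: "real^2 \<Rightarrow> real^2 \<Rightarrow> real" where
  "cross2 u v = u$1 * v$2 - u$2 * v$1"

text \<open>The Cayley image of the ratio of the two coordinates. In these homogeneous coordinates the modular
group acts linearly, and no case distinction for the point at infinity is needed.\<close>

definition circ :: "real^2 \<Rightarrow> complex" where
  "circ w = (of_real (w$1) - \<i> * of_real (w$2)) / (of_real (w$1) + \<i> * of_real (w$2))"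

lemma vec2_eq_iff: "u = v \<longleftrightarrow> u$1 = v$1 \<and> u$2 = v$2" for u v :: "real^2"
  by (simp add: vec_eq_iff forall_2)

lemma mat22_eq_iff:
  "X = Y \<longleftrightarrow> X$1$1 = Y$1$1 \<and> X$1$2 = Y$1$2 \<and> X$2$1 = Y$2$1 \<and> X$2$2 = Y$2$2" for X Y :: "real^2^2"
  by (auto simp: vec_eq_iff forall_2)

lemma matrix_vector_nth2:
  "(A *v w)$1 = A$1$1 * w$1 + A$1$2 * w$2" "(A *v w)$2 = A$2$1 * w$1 + A$2$2 * w$2"
  for A :: "real^2^2"
  by (simp_all add: matrix_vector_mult_def sum_2)

lemma matrix_matrix_nth2:
  "(A ** B)$1$1 = A$1$1 * B$1$1 + A$1$2 * B$2$1" "(A ** B)$1$2 = A$1$1 * B$1$2 + A$1$2 * B$2$2"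
  "(A ** B)$2$1 = A$2$1 * B$1$1 + A$2$2 * B$2$1" "(A ** B)$2$2 = A$2$1 * B$1$2 + A$2$2 * B$2$2"
  for A B :: "real^2^2"
  by (simp_all add: matrix_matrix_mult_def sum_2)

lemma cross2_linear:
  "cross2 u (v + w) = cross2 u v + cross2 u w" "cross2 (v + w) u = cross2 v u + cross2 w u"
  "cross2 u (v - w) = cross2 u v - cross2 u w" "cross2 (v - w) u = cross2 v u - cross2 w u"
  "cross2 u (k *\<^sub>R v) = k * cross2 u v" "cross2 (k *\<^sub>R v) u = k * cross2 v u"
  "cross2 u (- v) = - cross2 u v" "cross2 (- v) u = - cross2 v u" "cross2 u u = 0"
  by (simp_all add: cross2_def algebra_simps)

lemma cross2_swap: "cross2 v u = - cross2 u v"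
  by (simp add: cross2_def)

lemma cross2_matrix: "cross2 (A *v u) (A *v v) = det A * cross2 u v" for A :: "real^2^2"
  by (simp add: cross2_def matrix_vector_nth2 det_2 algebra_simps)

text \<open>Cramer's rule.\<close>

lemma cross2_expand:
  "cross2 p q *\<^sub>R w = cross2 w q *\<^sub>R p + cross2 p w *\<^sub>R q"
  by (simp add: vec2_eq_iff cross2_def algebra_simps)

lemma vec2_norm_nz: "w \<noteq> 0 \<longleftrightarrow> (w$1)\<^sup>2 + (w$(2::2))\<^sup>2 > 0" for w :: "real^2"
  by (simp add: vec2_eq_iff sum_power2_gt_zero_iff)

lemma circ_denominator_nz: "w \<noteq> 0 \<Longrightarrow> complex_of_real (w$1) + \<i> * of_real (w$2) \<noteq> 0"
  for w :: "real^2"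
  by (auto simp: complex_eq_iff vec2_eq_iff)

lemma Re_circ: "Re (circ w) = ((w$1)\<^sup>2 - (w$2)\<^sup>2) / ((w$1)\<^sup>2 + (w$2)\<^sup>2)"
  and Im_circ: "Im (circ w) = - 2 * w$1 * w$2 / ((w$1)\<^sup>2 + (w$2)\<^sup>2)"
  by (simp_all add: circ_def Re_divide Im_divide power2_eq_square algebra_simps)

lemma circ_eq_iff:
  assumes "u \<noteq> 0" "v \<noteq> 0"
  shows "circ u = circ v \<longleftrightarrow> cross2 u v = 0"
proof -
  have "circ u = circ v \<longleftrightarrow> 
     (of_real (u$1) - \<i> * of_real (u$2)) * (of_real (v$1) + \<i> * of_real (v$2)) =
     (of_real (v$1) - \<i> * of_real (v$2)) * (of_real (u$1) + \<i> * of_real (u$2))"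
    unfolding circ_def using assms[THEN circ_denominator_nz] by (rule frac_eq_eq)
  also have "\<dots> \<longleftrightarrow> cross2 u v = 0"
    by (auto simp add: complex_eq_iff cross2_def mult.commute)
  finally show ?thesis .
qed

lemma circ_scale: "k \<noteq> 0 \<Longrightarrow> circ (k *\<^sub>R w) = circ w"
  using circ_eq_iff[of "k *\<^sub>R w" w] by (cases "w = 0") (auto simp: cross2_linear)

definition slope :: "real^2 \<Rightarrow> hat_real" where
  "slope w = (if w$2 = 0 then Infty else Fin (w$1 / w$2))"

lemma cayley_slope: "w \<noteq> 0 \<Longrightarrow> cayley (slope w) = circ w"
proof (cases "w$2 = 0")
  case False
  define x y where xy: "x = complex_of_real (w$1)" "y = complex_of_real (w$2)"
  have "y \<noteq> 0" using False by (simp add: xy)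
  then have "x / y - \<i> = (x - \<i> * y) / y" "x / y + \<i> = (x + \<i> * y) / y"
    by (simp_all add: add_divide_distrib diff_divide_distrib)
  then show ?thesis
    using False \<open>y \<noteq> 0\<close> by (simp add: slope_def circ_def xy)
qed (auto simp: slope_def circ_def vec2_eq_iff)

lemma norm_circ: "w \<noteq> 0 \<Longrightarrow> norm (circ w) = 1"
  using cayley_in_circle[of "slope w"] by (simp add: cayley_slope)

lemma matrix_inv_vector_mult:
  assumes "A \<in> SL2Z"
  shows "A *v (matrix_inv A *v w) = w" "matrix_inv A *v (A *v w) = w"
  using matrix_inv_mult_SL2Z[OF assms] matrix_left_right_inverse[of A "matrix_inv A"]
  by (simp_all add: matrix_vector_mul_assoc)

lemma det_SL2Z: "A \<in> SL2Z \<Longrightarrow> det A = 1"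
  by (simp add: SL2Z_def)

lemma SL2Z_vector_nz:
  assumes "A \<in> SL2Z" "w \<noteq> 0"
  shows "A *v w \<noteq> 0"
  using assms by (metis matrix_inv_vector_mult(2) matrix_vector_mult_0_right)

lemma act_slope:
  assumes "A \<in> SL2Z" "w \<noteq> 0"
  shows "act (slope w) A = slope (matrix_inv A *v w)"
proof -
  define a b c d where abcd: "a = A$1$1" "b = A$1$2" "c = A$2$1" "d = A$2$2"
  have det: "a * d - b * c = 1"
    using assms(1) by (simp add: SL2Z_def det_2 abcd)
  have 1: "slope (matrix_inv A *v w) =
      (if a * w$2 - c * w$1 = 0 then Infty else Fin ((d * w$1 - b * w$2) / (a * w$2 - c * w$1)))"
    by (simp add: slope_def matrix_inv_SL2Z[OF assms(1)] matrix_vector_nth2 abcd algebra_simps)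
  show ?thesis
  proof (cases "w$2 = 0")
    case True
    then have "w$1 \<noteq> 0" using assms by (auto simp: vec2_eq_iff)
    then show ?thesis
      unfolding 1 using True by (auto simp: slope_def abcd)
  next
    case False
    have e: "- c * (w$1 / w$2) + a = (a * w$2 - c * w$1) / w$2"
      "d * (w$1 / w$2) - b = (d * w$1 - b * w$2) / w$2"
      using False by (simp_all add: field_simps)
    show ?thesis
      unfolding 1 slope_def[of w] using False by (simp only: act.simps if_False abcd(1-4)[symmetric] e) simp
  qed
qed

lemma circle_act_circ:
  assumes "A \<in> SL2Z" "w \<noteq> 0"
  shows "circle_act (circ w) A = circ (matrix_inv A *v w)"
proof -
  have "inv cayley (circ w) = slope w"
    using inv_f_f[OF inj_cayley, of "slope w"] assms(2) by (simp add: cayley_slope)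
  then show ?thesis
    using assms by (simp add: circle_act_def act_slope cayley_slope SL2Z_vector_nz matrix_inv_in_SL2Z)
qed

lemma wavelet_circ:
  assumes "A \<in> SL2Z" "w \<noteq> 0"
  shows "wavelet A (circ w) = matrix_inv A ** mother (circ (A *v w)) ** A"
proof -
  have "matrix_inv (matrix_inv A) = A"
    unfolding matrix_inv_SL2Z[OF matrix_inv_in_SL2Z[OF assms(1)]]
    by (simp add: matrix_inv_SL2Z[OF assms(1)] mat22_eq_iff)
  then show ?thesis
    by (simp add: wavelet_def circle_act_circ[OF matrix_inv_in_SL2Z[OF assms(1)] assms(2)])
qed

text \<open>The map \<open>circ\<close> doubles angles and reverses orientation, which accounts for the half angle and for
the minus sign. In particular, moving counter-clockwise on the circle means moving clockwise in
the coordinate plane.\<close>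

definition half_angle :: "real \<Rightarrow> real^2" where
  "half_angle t = vector [cos (t/2), - sin (t/2)]"

lemma half_angle_nth [simp]: "half_angle t $ 1 = cos (t/2)" "half_angle t $ 2 = - sin (t/2)"
  by (simp_all add: half_angle_def)

lemma half_angle_nz: "half_angle t \<noteq> 0"
  using sin_zero_abs_cos_one[of "t/2"] by (auto simp: vec2_eq_iff)

lemma circ_half_angle: "circ (half_angle t) = cis t"
  using cos_double[of "t/2"] sin_double[of "t/2"] sin_cos_squared_add2[of "t/2"]
  by (simp add: complex_eq_iff Re_circ Im_circ)

lemma cross2_half_angle: "cross2 (half_angle s) (half_angle t) = - sin ((t - s)/2)"
  using sin_diff[of "t/2" "s/2"] by (simp add: cross2_def diff_divide_distrib)

lemma circle_circ_cases:
  assumes "z \<in> circle"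
  obtains w where "w \<noteq> 0" "z = circ w"
  using assms half_angle_nz[of "Arg z"] circ_half_angle[of "Arg z"] cis_Arg[of z]
  by (metis norm_zero mem_sphere_0 sgn_eq zero_neq_one div_by_1 of_real_1)

text \<open>Twice the signed area of the triangle.\<close>

definition orient :: "complex \<Rightarrow> complex \<Rightarrow> complex \<Rightarrow> real" where
  "orient p q r = Im (cnj (q - p) * (r - p))"

text \<open>Cyclic order on the circle is thus decided by three determinants, which turns statements about
the position of Farey points into integer arithmetic.\<close>

lemma orient_circ:
  assumes "u \<noteq> 0" "v \<noteq> 0" "w \<noteq> 0"
  shows "orient (circ u) (circ v) (circ w) = 4 * (cross2 u v * cross2 v w * cross2 w u) /
     (((u$1)\<^sup>2 + (u$2)\<^sup>2) * ((v$1)\<^sup>2 + (v$2)\<^sup>2) * ((w$1)\<^sup>2 + (w$2)\<^sup>2))"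
proof -
  define a b c d e f where abc: "a = u$1" "b = u$2" "c = v$1" "d = v$2" "e = w$1" "f = w$2"
  define k l m where klm: "k = a\<^sup>2 + b\<^sup>2" "l = c\<^sup>2 + d\<^sup>2" "m = e\<^sup>2 + f\<^sup>2"
  have nz: "k \<noteq> 0" "l \<noteq> 0" "m \<noteq> 0"
    using assms by (auto simp: vec2_norm_nz abc klm)
  have "orient (circ u) (circ v) (circ w) =
     ((c\<^sup>2-d\<^sup>2)/l - (a\<^sup>2-b\<^sup>2)/k) * (-2*e*f/m - -2*a*b/k)
      - (-2*c*d/l - -2*a*b/k) * ((e\<^sup>2-f\<^sup>2)/m - (a\<^sup>2-b\<^sup>2)/k)"
    by (simp add: orient_def Re_circ Im_circ abc klm algebra_simps)
  also have "\<dots> = (((c\<^sup>2-d\<^sup>2)*k - (a\<^sup>2-b\<^sup>2)*l) * (-2*e*f*k - -2*a*b*m)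
      - (-2*c*d*k - -2*a*b*l) * ((e\<^sup>2-f\<^sup>2)*k - (a\<^sup>2-b\<^sup>2)*m)) / (k*l*m*k)"
    using nz by (simp add: field_simps)
  also have "((c\<^sup>2-d\<^sup>2)*k - (a\<^sup>2-b\<^sup>2)*l) * (-2*e*f*k - -2*a*b*m)
      - (-2*c*d*k - -2*a*b*l) * ((e\<^sup>2-f\<^sup>2)*k - (a\<^sup>2-b\<^sup>2)*m)
      = k * (4 * ((a*d-b*c) * (c*f-d*e) * (e*b-f*a)))"
    unfolding klm by algebra
  finally show ?thesis
    using nz by (simp add: cross2_def abc klm mult_ac)
qed

section \<open>Chords and ideal triangles\<close>

text \<open>The inverse of \<open>klein\<close> on the open disk.\<close>

definition unklein :: "complex \<Rightarrow> complex" where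
  "unklein w = (1 / (1 + sqrt (1 - (norm w)\<^sup>2))) *\<^sub>R w"

lemma klein_unklein:
  assumes "w \<in> ball 0 1"
  shows "unklein w \<in> ball 0 1" "klein (unklein w) = w"
proof -
  define s where "s = sqrt (1 - (norm w)\<^sup>2)"
  have "(norm w)\<^sup>2 < 1"
    using assms by (simp add: power_less_one_iff)
  then have s: "s > 0" "(norm w)\<^sup>2 = 1 - s\<^sup>2"
    by (simp_all add: s_def)
  have "(norm (unklein w))\<^sup>2 = (1 - s\<^sup>2) / (1 + s)\<^sup>2"
    using s by (simp add: unklein_def s_def[symmetric] power_divide)
  also have "\<dots> = (1 - s) / (1 + s)"
    using s by (simp add: divide_simps) (simp add: power2_eq_square algebra_simps)
  finally have n: "(norm (unklein w))\<^sup>2 = (1 - s) / (1 + s)" .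
  then have "(norm (unklein w))\<^sup>2 < 1"
    using s by simp
  then show "unklein w \<in> ball 0 1"
    by (simp add: power_less_one_iff)
  have "2 / (1 + (norm (unklein w))\<^sup>2) = 1 + s"
    using s by (simp add: n divide_simps)
  then show "klein (unklein w) = w"
    using s by (simp add: klein_def unklein_def s_def[symmetric])
qed

lemma unklein_klein:
  assumes "z \<in> ball 0 1"
  shows "klein z \<in> ball 0 1" "unklein (klein z) = z"
proof -
  define r where "r = (norm z)\<^sup>2"
  have r: "0 \<le> r" "r < 1"
    using assms by (simp_all add: r_def power_less_one_iff)
  have "(norm (klein z))\<^sup>2 = 4 * r / (1 + r)\<^sup>2"
    by (simp add: klein_def r_def power_divide power_mult_distrib)
  also have "\<dots> = 1 - ((1 - r) / (1 + r))\<^sup>2"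
    using r by (simp add: divide_simps) (simp add: power2_eq_square algebra_simps)
  finally have n: "1 - (norm (klein z))\<^sup>2 = ((1 - r) / (1 + r))\<^sup>2"
    by simp
  moreover have pos: "(1 - r) / (1 + r) > 0"
    using r by simp
  ultimately have "1 - (norm (klein z))\<^sup>2 > 0" "sqrt (1 - (norm (klein z))\<^sup>2) = (1 - r) / (1 + r)"
    by (simp_all only: n real_sqrt_abs abs_of_pos[OF pos]) (simp only: zero_less_power pos)
  moreover have "1 / (1 + (1 - r) / (1 + r)) * (2 / (1 + r)) = 1"
    using r by (simp add: divide_simps)
  ultimately show "klein z \<in> ball 0 1" "unklein (klein z) = z"
    by (simp_all add: power_less_one_iff unklein_def)
       (simp add: klein_def r_def)
qed

lemma klein_preimage:
  assumes "S \<subseteq> ball 0 1"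
  shows "klein ` {z \<in> ball 0 1. klein z \<in> S} = S" "{z \<in> ball 0 1. klein z \<in> S} = unklein ` S"
proof -
  have "w \<in> klein ` {z \<in> ball 0 1. klein z \<in> S}" if "w \<in> S" for w
    using klein_unklein[of w] that assms by (intro image_eqI[of _ _ "unklein w"]) auto
  then show "klein ` {z \<in> ball 0 1. klein z \<in> S} = S" by blast
  have "z \<in> unklein ` S" if "z \<in> ball 0 1" "klein z \<in> S" for z
    using unklein_klein[of z] that by (intro image_eqI[of _ _ "klein z"]) auto
  then show "{z \<in> ball 0 1. klein z \<in> S} = unklein ` S"
    using assms klein_unklein by fastforce
qed

lemma continuous_on_klein: "continuous_on S klein"
proof -
  have "1 + (norm z)\<^sup>2 \<noteq> 0" for z :: complex
    by (metis add_pos_nonneg less_irrefl zero_le_power2 zero_less_one)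
  then show ?thesis
    unfolding klein_def by (intro continuous_intros) auto
qed

lemma continuous_on_unklein: "continuous_on (ball 0 1) unklein"
proof -
  have "1 + sqrt (1 - (norm z)\<^sup>2) \<noteq> 0" if "z \<in> ball 0 1" for z :: complex
  proof -
    have "(norm z)\<^sup>2 \<le> 1" using that by (simp add: power_le_one_iff)
    then have "sqrt (1 - (norm z)\<^sup>2) \<ge> 0" by simp
    then show ?thesis by linarith
  qed
  then show ?thesis
    unfolding unklein_def by (intro continuous_intros) auto
qed

lemma open_segment_in_ball:
  fixes p q :: complex
  assumes "p \<in> cball 0 1" "q \<in> cball 0 1"
  shows "open_segment p q \<subseteq> ball 0 1"
proof
  fix z assume "z \<in> open_segment p q"
  from dist_decreases_open_segment[OF this, of 0] assms show "z \<in> ball 0 1"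
    by (auto simp: dist_norm)
qed

text \<open>The end points of a geodesic are recovered as the points of the circle in the closure of its chord.\<close>

lemma geodesic_eq_iff:
  assumes "p \<in> circle" "q \<in> circle" "p' \<in> circle" "q' \<in> circle" "p \<noteq> q" "p' \<noteq> q'"
  shows "geodesic p q = geodesic p' q' \<longleftrightarrow> {p, q} = {p', q'}"
proof
  have ends: "closure (klein ` geodesic p q) \<inter> circle = {p, q}"
    if "p \<in> circle" "q \<in> circle" "p \<noteq> q" for p q :: complex
  proof -
    have sub: "open_segment p q \<subseteq> ball 0 1"
      using that by (intro open_segment_in_ball) auto
    then have "closure (klein ` geodesic p q) = closed_segment p q"
      unfolding geodesic_def klein_preimage(1)[OF sub] using that by simp
    also have "\<dots> = insert p (insert q (open_segment p q))"
      by (auto simp: open_segment_def)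
    moreover have "open_segment p q \<inter> circle = {}"
      using sub by fastforce
    ultimately show ?thesis
      using that by (simp add: Int_insert_left)
  qed
  show "{p, q} = {p', q'}" if "geodesic p q = geodesic p' q'"
    using that ends[of p q] ends[of p' q'] assms by simp
  show "geodesic p q = geodesic p' q'" if "{p, q} = {p', q'}"
    using that by (auto simp: doubleton_eq_iff geodesic_def open_segment_commute)
qed

lemma geodesic_commute: "geodesic p q = geodesic q p"
  by (simp add: geodesic_def open_segment_commute)

lemma orient_inner: "orient p q z = Complex (- Im (q - p)) (Re (q - p)) \<bullet> z - Complex (- Im (q - p)) (Re (q - p)) \<bullet> p"
  by (simp add: orient_def inner_complex_def algebra_simps)

lemma orient_rotate: "orient q r p = orient p q r"
  and orient_swap: "orient q p r = - orient p q r"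
  by (simp_all add: orient_def algebra_simps)

lemma orient_degenerate: "orient p p r = 0" "orient p q p = 0" "orient p q q = 0"
  by (simp_all add: orient_def algebra_simps)

lemma clockwise_iff_orient:
  "clockwise p q r \<longleftrightarrow> p \<in> circle \<and> q \<in> circle \<and> r \<in> circle \<and> orient p q r < 0"
  by (simp add: clockwise_def orient_def)

text \<open>The centroid is an interior point when the vertices are not collinear.\<close>

lemma interior_triangle_nonempty:
  assumes "orient p q r \<noteq> 0"
  shows "interior (convex hull {p, q, r}) \<noteq> {}"
proof -
  have "\<not> collinear {p, q, r}"
  proof
    assume "collinear {p, q, r}"
    then have "collinear {0, p - q, r - q}" by (simp add: collinear_3)
    then consider "p = q" | "r = q" | c where "r - q = c *\<^sub>R (p - q)"
      by (auto simp: collinear_lemma)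
    then show False
    proof cases
      case 3
      then have "r = q + c *\<^sub>R (p - q)" by (simp only: diff_eq_eq add.commute)
      then show False using assms by (simp add: orient_def) (simp add: algebra_simps)
    qed (use assms in \<open>auto simp: orient_degenerate\<close>)
  qed
  moreover have "(1/3) *\<^sub>R p + (1/3) *\<^sub>R q + (1/3) *\<^sub>R r \<in>
      {v. \<exists>x y z. 0 < x \<and> 0 < y \<and> 0 < z \<and> x + y + z = 1 \<and> x *\<^sub>R p + y *\<^sub>R q + z *\<^sub>R r = v}"
    by (force intro!: exI[of _ "1/3::real"])
  ultimately show ?thesis
    by (subst interior_convex_hull_3_minimal) auto
qed

lemma triangle_in_cball:
  assumes "p \<in> circle" "q \<in> circle" "r \<in> circle"
  shows "convex hull {p, q, r} \<subseteq> cball 0 1" "interior (convex hull {p, q, r}) \<subseteq> ball 0 1"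
proof -
  show "convex hull {p, q, r} \<subseteq> cball 0 1"
    using assms by (intro hull_minimal) auto
  from interior_mono[OF this] show "interior (convex hull {p, q, r}) \<subseteq> ball 0 1"
    by simp
qed

text \<open>The disk is strictly convex, so a point of the circle that lies in the triangle is an extreme point
of the triangle, and therefore a vertex.\<close>

lemma ideal_triangle_vertices:
  assumes "p \<in> circle" "q \<in> circle" "r \<in> circle" "orient p q r \<noteq> 0"
  shows "closure (klein ` ideal_triangle p q r) \<inter> circle = {p, q, r}"
proof -
  let ?H = "convex hull {p, q, r}"
  have "closure (klein ` ideal_triangle p q r) = closure (interior ?H)"
    unfolding ideal_triangle_def
    using klein_preimage(1)[OF triangle_in_cball(2)[OF assms(1-3)]] by simp
  also have "\<dots> = closure ?H"
    by (rule convex_closure_interior) (use interior_triangle_nonempty[OF assms(4)] in auto)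
  also have "\<dots> = ?H"
    by (simp add: compact_convex_hull compact_imp_closed)
  finally have cl: "closure (klein ` ideal_triangle p q r) = ?H" .
  have "x \<in> {p, q, r}" if x: "x \<in> ?H" "x \<in> circle" for x
  proof -
    have "x extreme_point_of ?H"
      unfolding extreme_point_of_def
      using x open_segment_in_ball triangle_in_cball(1)[OF assms(1-3)] by fastforce
    then show ?thesis by (rule extreme_point_of_convex_hull)
  qed
  then show ?thesis
    using cl assms(1-3) hull_subset[of "{p, q, r}" convex] by blast
qed

text \<open>The vertices are determined as a set, and among their six orders only the three rotations of a
clockwise one are clockwise.\<close>

lemma has_clockwise_edges_unique:
  assumes "has_clockwise_edges T (a, b, c)" "has_clockwise_edges T abc"
  shows "abc \<in> {(a, b, c), (b, c, a), (c, a, b)}"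
proof -
  obtain p q r where pqr: "clockwise p q r" "T = ideal_triangle p q r"
      "(a, b, c) = (geodesic p q, geodesic q r, geodesic r p)"
    using assms(1) by (auto simp: has_clockwise_edges_def)
  obtain p' q' r' where pqr': "clockwise p' q' r'" "T = ideal_triangle p' q' r'"
      "abc = (geodesic p' q', geodesic q' r', geodesic r' p')"
    using assms(2) by (auto simp: has_clockwise_edges_def)
  have "{p, q, r} = {p', q', r'}"
    using ideal_triangle_vertices[of p q r] ideal_triangle_vertices[of p' q' r'] pqr pqr'
    by (simp add: clockwise_iff_orient)
  moreover have neg: "orient p q r < 0" "orient p' q' r' < 0"
    using pqr pqr' by (simp_all add: clockwise_iff_orient)
  moreover have "p \<noteq> q" "q \<noteq> r" "p \<noteq> r" "p' \<noteq> q'" "q' \<noteq> r'" "p' \<noteq> r'"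
    using neg by (auto simp: orient_degenerate)
  ultimately have "(p', q', r') \<in> {(p, q, r), (q, r, p), (r, p, q)} \<or>
     (p', q', r') \<in> {(q, p, r), (p, r, q), (r, q, p)}"
    by (metis insert_iff singletonD)
  moreover have "orient q p r = - orient p q r" "orient p r q = - orient p q r"
      "orient r q p = - orient p q r"
    by (simp_all add: orient_def algebra_simps)
  then have "(p', q', r') \<notin> {(q, p, r), (p, r, q), (r, q, p)}"
    using neg \<open>orient q p r = - orient p q r\<close> \<open>orient p r q = - orient p q r\<close>
      \<open>orient r q p = - orient p q r\<close>
    by auto
  ultimately show ?thesis
    using pqr(3) pqr'(3) by auto
qed

lemma has_clockwise_edges_distinct:
  assumes "has_clockwise_edges T (a, b, c)"
  shows "a \<noteq> b" "b \<noteq> c" "a \<noteq> c"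
proof -
  obtain p q r where pqr: "clockwise p q r" 
      "a = geodesic p q" "b = geodesic q r" "c = geodesic r p"
    using assms by (auto simp: has_clockwise_edges_def)
  moreover have "p \<noteq> q" "q \<noteq> r" "p \<noteq> r"
    using pqr by (auto simp: clockwise_iff_orient orient_degenerate)
  ultimately show "a \<noteq> b" "b \<noteq> c" "a \<noteq> c"
    by (simp_all add: clockwise_iff_orient geodesic_eq_iff doubleton_eq_iff)
qed

lemma has_clockwise_edges_clockwise_edges:
  "has_clockwise_edges T abc \<Longrightarrow> has_clockwise_edges T (clockwise_edges T)"
  unfolding clockwise_edges_def by (rule someI)

lemma has_clockwise_edges_rotate:
  assumes "has_clockwise_edges T (a, b, c)"
  shows "has_clockwise_edges T (b, c, a)"
proof -
  obtain p q r where pqr: "clockwise p q r" "T = ideal_triangle p q r"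
      "a = geodesic p q" "b = geodesic q r" "c = geodesic r p"
    using assms by (auto simp: has_clockwise_edges_def)
  have "clockwise q r p" "T = ideal_triangle q r p"
    using pqr(1,2) orient_rotate[of q r p] by (simp_all add: clockwise_iff_orient ideal_triangle_def insert_commute)
  then show ?thesis
    using pqr(3-5) unfolding has_clockwise_edges_def by blast
qed

text \<open>The side \<open>p q\<close> spans a line, and the triangle lies on the side of \<open>r\<close>. If neither end of a chord
is strictly on that side, then by convexity no point of the chord is.\<close>

lemma chord_beyond_side:
  assumes "orient p q r \<noteq> 0"
    and "orient p q x * orient p q r \<le> 0" "orient p q y * orient p q r \<le> 0"
  shows "open_segment x y \<inter> interior (convex hull {p, q, r}) = {}"
proof -
  define s where "s = orient p q r"
  define n where "n = s *\<^sub>R Complex (- Im (q - p)) (Re (q - p))"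
  have f: "orient p q z * s = n \<bullet> z - n \<bullet> p" for z
    by (simp add: orient_inner n_def algebra_simps)
  have "n \<noteq> 0"
    using f[of r] assms(1) by (auto simp: s_def)
  have "convex hull {p, q, r} \<subseteq> {z. n \<bullet> z \<ge> n \<bullet> p}"
    using f[of p] f[of q] f[of r] zero_le_square[of s]
    by (intro hull_minimal) (auto simp: convex_halfspace_ge orient_degenerate s_def)
  from interior_mono[OF this] have "interior (convex hull {p, q, r}) \<subseteq> {z. n \<bullet> z > n \<bullet> p}"
    using \<open>n \<noteq> 0\<close> by simp
  moreover have "open_segment x y \<subseteq> {z. n \<bullet> z \<le> n \<bullet> p}"
  proof -
    have "x \<in> {z. n \<bullet> z \<le> n \<bullet> p}" "y \<in> {z. n \<bullet> z \<le> n \<bullet> p}"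
      using assms(2,3) f[of x] f[of y] by (auto simp: s_def)
    then show ?thesis
      using convex_halfspace_le[of n "n \<bullet> p"] by (simp add: convex_contains_open_segment)
  qed
  ultimately show ?thesis by force
qed

text \<open>The frontier of the triangle consists of the three sides, which lie over \<open>G\<close>, and of the vertices,
which are not in the open disk. A connected set that avoids \<open>G\<close> and meets the triangle therefore
cannot leave it.\<close>

lemma ideal_triangle_component:
  assumes "p \<in> circle" "q \<in> circle" "r \<in> circle" "orient p q r \<noteq> 0"
    and "geodesic p q \<subseteq> G" "geodesic q r \<subseteq> G" "geodesic r p \<subseteq> G"
    and disj: "ideal_triangle p q r \<inter> G = {}"
  shows "ideal_triangle p q r \<in> components (ball 0 1 - G)"
proof -
  let ?H = "convex hull {p, q, r}"
  let ?I = "interior ?H"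
  have sub: "?I \<subseteq> ball 0 1"
    using triangle_in_cball assms by blast
  have T: "ideal_triangle p q r = unklein ` ?I"
    unfolding ideal_triangle_def by (rule klein_preimage(2)[OF sub])
  have ne: "ideal_triangle p q r \<noteq> {}"
    unfolding T using interior_triangle_nonempty[OF assms(4)] by simp
  have conn: "connected (ideal_triangle p q r)"
    unfolding T
    by (intro connected_continuous_image continuous_on_subset[OF continuous_on_unklein] sub
        convex_connected convex_interior convex_convex_hull)
  have frontier: "unklein w \<in> G" if "w \<in> frontier ?H \<inter> ball 0 1" for w
  proof -
    have w: "w \<in> frontier ?H \<inter> ball 0 1" using that .
    then have "w \<in> closed_segment p q \<union> closed_segment q r \<union> closed_segment r p" "w \<noteq> p" "w \<noteq> q" "w \<noteq> r"
      using frontier_of_triangle[of p q r] assms by auto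
    then have "w \<in> open_segment p q \<union> open_segment q r \<union> open_segment r p"
      by (auto simp: open_segment_def)
    moreover have "unklein w \<in> ball 0 1" "klein (unklein w) = w"
      using klein_unklein[of w] w by auto
    ultimately have "unklein w \<in> geodesic p q \<union> geodesic q r \<union> geodesic r p"
      by (auto simp: geodesic_def)
    then show "unklein w \<in> G"
      using assms(5-7) by blast
  qed
  have "D = ideal_triangle p q r"
    if D: "D \<noteq> {}" "ideal_triangle p q r \<subseteq> D" "D \<subseteq> ball 0 1 - G" "connected D" for D
  proof -
    have "klein ` D \<inter> frontier ?H = {}"
    proof (rule ccontr)
      assume "klein ` D \<inter> frontier ?H \<noteq> {}"
      then obtain z where z: "z \<in> D" "klein z \<in> frontier ?H" by blast
      then have "z \<in> ball 0 1" using D by blast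
      then have "unklein (klein z) \<in> G"
        using frontier z unklein_klein(1) by blast
      then show False
        using D z unklein_klein(2)[of z] by auto
    qed
    moreover have "connected (klein ` D)"
      using D by (intro connected_continuous_image continuous_on_klein)
    moreover have "klein ` D \<inter> ?H \<noteq> {}"
      using D(2) ne interior_subset[of ?H] unfolding ideal_triangle_def by blast
    ultimately have "klein ` D \<subseteq> ?H"
      using connected_Int_frontier[of "klein ` D" ?H] by blast
    then have "klein ` D \<subseteq> ?I"
      using \<open>klein ` D \<inter> frontier ?H = {}\<close> closure_subset[of ?H] unfolding frontier_def by blast
    then show ?thesis
      using D unfolding ideal_triangle_def by blast
  qed
  moreover have "ideal_triangle p q r \<subseteq> ball 0 1 - G"
    using disj by (auto simp: ideal_triangle_def)
  ultimately show ?thesis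
    unfolding in_components_maximal using ne conn by blast
qed

lemma ideal_triangle_disjoint_geodesic:
  assumes "orient p q r \<noteq> 0"
    and "orient p q x * orient p q r \<le> 0" "orient p q y * orient p q r \<le> 0"
  shows "ideal_triangle p q r \<inter> geodesic x y = {}"
  using chord_beyond_side[OF assms] unfolding ideal_triangle_def geodesic_def by blast

section \<open>Farey edges and Farey triangles\<close>

text \<open>Both signs of the determinant are admitted because edges are unoriented.\<close>

definition lattice_basis :: "real^2 \<Rightarrow> real^2 \<Rightarrow> bool" where
  "lattice_basis p q \<longleftrightarrow> (\<forall>i. p$i \<in> \<int>) \<and> (\<forall>i. q$i \<in> \<int>) \<and> \<bar>cross2 p q\<bar> = 1"

text \<open>The Farey point with coordinates \<open>(x, y)\<close> in the frame of the edge of \<open>A\<close>: the coordinates \<open>(1, 0)\<close>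
and \<open>(0, 1)\<close> give the ends of that edge, and \<open>(1, 1)\<close> and \<open>(1, -1)\<close> give the vertices opposite to it
in its two adjacent triangles.\<close>

abbreviation edge_frame :: "real^2^2 \<Rightarrow> real \<Rightarrow> real \<Rightarrow> complex" where
  "edge_frame A x y \<equiv> circ (matrix_inv A *v vector [x, y])"

lemma lattice_basis_nz: "lattice_basis p q \<Longrightarrow> p \<noteq> 0 \<and> q \<noteq> 0"
  by (auto simp: lattice_basis_def cross2_def)

lemma lattice_basis_commute: "lattice_basis p q \<longleftrightarrow> lattice_basis q p"
  using cross2_swap[of p q] by (auto simp: lattice_basis_def)

lemma lattice_basis_add: "lattice_basis p q \<Longrightarrow> lattice_basis p (p + q)"
  by (auto simp: lattice_basis_def cross2_linear)

lemma lattice_basis_circ: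
  assumes "lattice_basis p q"
  shows "circ p \<in> circle" "circ p \<noteq> circ q"
  using assms lattice_basis_nz[OF assms] by (auto simp: norm_circ circ_eq_iff lattice_basis_def)

lemma vector2_nz: "(vector [x, y] :: real^2) \<noteq> 0 \<longleftrightarrow> x \<noteq> 0 \<or> y \<noteq> 0"
  by (auto simp: vec2_eq_iff)

lemma edge_eq_frame:
  assumes "A \<in> SL2Z"
  shows "edge A = geodesic (edge_frame A 1 0) (edge_frame A 0 1)"
proof -
  have "slope (vector [0, 1]) = Fin 0" "slope (vector [1, 0]) = Infty"
    by (simp_all add: slope_def)
  then have "edge A = geodesic (cayley (slope (matrix_inv A *v vector [0, 1])))
      (cayley (slope (matrix_inv A *v vector [1, 0])))"
    unfolding edge_def using assms act_slope[of A "vector [0, 1]"] act_slope[of A "vector [1, 0]"]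
    by (simp add: vector2_nz)
  then show ?thesis
    using assms geodesic_commute
    by (simp add: cayley_slope SL2Z_vector_nz matrix_inv_in_SL2Z vector2_nz)
qed

lemma frame_lattice_basis:
  assumes "A \<in> SL2Z" "x \<in> \<int>" "y \<in> \<int>" "x' \<in> \<int>" "y' \<in> \<int>" "\<bar>x * y' - y * x'\<bar> = 1"
  shows "lattice_basis (matrix_inv A *v vector [x, y]) (matrix_inv A *v vector [x', y'])"
proof -
  have "(matrix_inv A *v w) $ i \<in> \<int>" if "w$1 \<in> \<int>" "w$2 \<in> \<int>" for w i
    using matrix_inv_in_SL2Z[OF assms(1)] that by (auto simp: SL2Z_def matrix_vector_mult_def sum_2)
  then show ?thesis
    using assms det_SL2Z[OF matrix_inv_in_SL2Z[OF assms(1)]]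
    by (simp add: lattice_basis_def cross2_matrix) (simp add: cross2_def)
qed

text \<open>The vectors \<open>p\<close> and \<open>\<plusminus> q\<close>, with the sign that makes the determinant one, are the columns of the
inverse of the required matrix.\<close>

lemma lattice_basis_edge_in_farey:
  assumes "lattice_basis p q"
  shows "geodesic (circ p) (circ q) \<in> farey"
proof -
  define q' where "q' = cross2 p q *\<^sub>R q"
  have s: "cross2 p q = 1 \<or> cross2 p q = -1"
    using assms by (auto simp: lattice_basis_def)
  then have q': "cross2 p q' = 1" "circ q' = circ q" "\<forall>i. q' $ i \<in> \<int>"
    using assms circ_scale[of "-1" q] by (auto simp: q'_def cross2_linear lattice_basis_def)
  define A where "A = mat2 (q'$2) (- q'$1) (- p$2) (p$1)"
  have A: "A \<in> SL2Z"
    using q' assms by (auto simp: A_def SL2Z_def det_2 forall_2 lattice_basis_def cross2_def mult.commute)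
  have "matrix_inv A *v vector [1, 0] = p" "matrix_inv A *v vector [0, 1] = q'"
    unfolding matrix_inv_SL2Z[OF A] by (simp_all add: vec2_eq_iff matrix_vector_nth2 A_def)
  then have "edge A = geodesic (circ p) (circ q)"
    using edge_eq_frame[OF A] q'(2) by simp
  then show ?thesis
    using A by (auto simp: farey_def)
qed

lemma farey_edgeE:
  assumes "e \<in> farey"
  obtains p q where "lattice_basis p q" "e = geodesic (circ p) (circ q)"
proof -
  obtain A where A: "A \<in> SL2Z" "e = edge A"
    using assms by (auto simp: farey_def)
  show ?thesis
    by (rule that[of "matrix_inv A *v vector [1, 0]" "matrix_inv A *v vector [0, 1]"])
       (use A in \<open>simp_all add: frame_lattice_basis edge_eq_frame\<close>)
qed

text \<open>A vector that belongs to a lattice basis is primitive. If two such vectors are proportional, then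
the factor and its inverse are both integers.\<close>

lemma lattice_basis_circ_eq:
  assumes "lattice_basis p q" "lattice_basis p' q'" "circ p = circ p'"
  shows "p' = p \<or> p' = - p"
proof -
  have 0: "cross2 p p' = 0"
    using assms lattice_basis_nz[OF assms(1)] lattice_basis_nz[OF assms(2)] by (simp add: circ_eq_iff)
  define k where "k = cross2 p' q * cross2 p q"
  define k' where "k' = cross2 p q' * cross2 p' q'"
  have sq: "cross2 p q * cross2 p q = 1" "cross2 p' q' * cross2 p' q' = 1"
    using assms by (simp_all add: lattice_basis_def abs_eq_iff flip: abs_mult_self_eq[of "cross2 p _"] abs_mult_self_eq[of "cross2 p' _"])
  have "cross2 p q *\<^sub>R (cross2 p q *\<^sub>R p') = cross2 p q *\<^sub>R (cross2 p' q *\<^sub>R p)"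
    "cross2 p' q' *\<^sub>R (cross2 p' q' *\<^sub>R p) = cross2 p' q' *\<^sub>R (cross2 p q' *\<^sub>R p')"
    using cross2_expand[of p q p'] cross2_expand[of p' q' p] 0 cross2_swap[of p p'] by simp_all
  then have p': "p' = k *\<^sub>R p" and p: "p = k' *\<^sub>R p'"
    using sq by (simp_all add: k_def k'_def mult.commute)
  have "k * k' = 1"
    using p p' lattice_basis_nz[OF assms(1)] by (metis scaleR_cancel_right scaleR_one scaleR_scaleR mult.commute)
  moreover have "k \<in> \<int>" "k' \<in> \<int>"
    unfolding k_def k'_def using assms by (auto simp: lattice_basis_def cross2_def)
  then obtain i j where "k = of_int i" "k' = of_int j" by (auto elim!: Ints_cases)
  ultimately have "i * j = 1"
    by (metis of_int_1 of_int_eq_iff of_int_mult)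
  then have "i = 1 \<or> i = -1"
    using zmult_eq_1_iff by blast
  then show ?thesis
    using p' \<open>k = of_int i\<close> by auto
qed

lemma farey_edge_between:
  assumes "geodesic P Q \<in> farey" "P \<in> circle" "Q \<in> circle" "P \<noteq> Q"
  obtains p q where "lattice_basis p q" "P = circ p" "Q = circ q"
proof -
  obtain p q where pq: "lattice_basis p q" "geodesic P Q = geodesic (circ p) (circ q)"
    using farey_edgeE[OF assms(1)] .
  have qp: "lattice_basis q p" using pq lattice_basis_commute by blast
  have "{P, Q} = {circ p, circ q}"
    using pq assms lattice_basis_circ[OF pq(1)] lattice_basis_circ[OF qp] geodesic_eq_iff by metis
  then show ?thesis
    using that pq(1) qp by (auto simp: doubleton_eq_iff)
qed

text \<open>A vertex joined to both \<open>p\<close> and \<open>q\<close> has determinant \<open>\<plusminus>1\<close> with each of them, so both of its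
coordinates in the basis \<open>p, q\<close> are \<open>\<plusminus>1\<close>.\<close>

lemma farey_third_vertex:
  assumes "lattice_basis p q" "geodesic (circ q) R \<in> farey" "geodesic R (circ p) \<in> farey"
    "R \<in> circle" "R \<noteq> circ p" "R \<noteq> circ q"
  shows "R = circ (p + q) \<or> R = circ (p - q)"
proof -
  have qp: "lattice_basis q p" using assms lattice_basis_commute by blast
  obtain q' r where qr: "lattice_basis q' r" "circ q = circ q'" "R = circ r"
    using farey_edge_between[OF assms(2)] assms lattice_basis_circ[OF qp] by metis
  obtain r' p' where rp: "lattice_basis r' p'" "R = circ r'" "circ p = circ p'"
    using farey_edge_between[OF assms(3)] assms lattice_basis_circ[OF assms(1)] by metis
  have "q' = q \<or> q' = - q"
    by (rule lattice_basis_circ_eq[OF qp qr(1,2)])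
  then have cqr: "\<bar>cross2 q r\<bar> = 1"
    using qr(1) by (auto simp: lattice_basis_def cross2_linear)
  have "lattice_basis p' r'" "lattice_basis r q'" using rp(1) qr(1) lattice_basis_commute by blast+
  have "p' = p \<or> p' = - p"
    by (rule lattice_basis_circ_eq[OF assms(1) \<open>lattice_basis p' r'\<close> rp(3)])
  moreover have "r' = r \<or> r' = - r"
    using lattice_basis_circ_eq[OF \<open>lattice_basis r q'\<close> rp(1)] qr(3) rp(2) by simp
  ultimately have cpr: "\<bar>cross2 p r\<bar> = 1"
    using rp(1) by (auto simp: lattice_basis_def cross2_linear cross2_swap[of r p])
  have "\<bar>cross2 p q\<bar> = 1" using assms(1) by (simp add: lattice_basis_def)
  have nz: "r \<noteq> 0" using lattice_basis_nz[OF qr(1)] by simp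
  define k where "k = cross2 p q"
  have e: "k *\<^sub>R r = cross2 r q *\<^sub>R p + cross2 p r *\<^sub>R q"
    unfolding k_def by (rule cross2_expand)
  have "cross2 r q = 1 \<or> cross2 r q = -1" "cross2 p r = 1 \<or> cross2 p r = -1"
    using cqr cpr by (auto simp: cross2_swap[of r q])
  then have "k *\<^sub>R r \<in> {p + q, p - q, (-1) *\<^sub>R (p - q), (-1) *\<^sub>R (p + q)}"
    using e by auto
  moreover have "k \<noteq> 0" using \<open>\<bar>cross2 p q\<bar> = 1\<close> by (auto simp: k_def)
  ultimately have "circ r = circ (p + q) \<or> circ r = circ (p - q)"
    using circ_scale[of k r] circ_scale[of "-1" "p - q"] circ_scale[of "-1" "p + q"] by fastforce
  then show ?thesis using qr(3) by simp
qed

lemma Ints_consecutive_mult_nonneg: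
  fixes x y :: real
  assumes "x \<in> \<int>" "y \<in> \<int>" "\<bar>x - y\<bar> = 1"
  shows "x * y \<ge> 0"
proof -
  obtain i j where ij: "x = of_int i" "y = of_int j"
    using assms by (auto elim!: Ints_cases)
  then have "\<bar>i - j\<bar> = 1"
    using assms(3) by linarith
  then have "i \<ge> 0 \<and> j \<ge> 0 \<or> i \<le> 0 \<and> j \<le> 0" by linarith
  then have "i * j \<ge> 0" by (auto simp: zero_le_mult_iff)
  then show ?thesis using ij by (metis of_int_0_le_iff of_int_mult)
qed

text \<open>The two factors are, up to positive constants and a common sign, the positions of the points \<open>x\<close> and
\<open>y\<close> relative to the edge \<open>p q\<close>. If \<open>x\<close> has coordinates \<open>(m, n)\<close> and \<open>y\<close> has coordinates \<open>(m', n')\<close> in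
the basis \<open>p, q\<close>, then the integers \<open>m n'\<close> and \<open>m' n\<close> differ by one and so cannot have opposite signs,
whereas for \<open>x\<close> and \<open>y\<close> strictly on different sides they would.\<close>

lemma farey_noncrossing:
  assumes "lattice_basis p q" "lattice_basis x y"
  shows "(cross2 x q * cross2 p x) * (cross2 y q * cross2 p y) \<ge> 0"
proof -
  have pl: "cross2 x q * cross2 p y - cross2 y q * cross2 p x = cross2 p q * cross2 x y"
    by (simp add: cross2_def algebra_simps)
  have "\<bar>cross2 p q * cross2 x y\<bar> = 1"
    using assms by (simp add: lattice_basis_def abs_mult)
  moreover have "cross2 x q * cross2 p y \<in> \<int>" "cross2 y q * cross2 p x \<in> \<int>"
    using assms by (auto simp: lattice_basis_def cross2_def)
  ultimately have "(cross2 x q * cross2 p y) * (cross2 y q * cross2 p x) \<ge> 0"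
    using pl by (intro Ints_consecutive_mult_nonneg) simp_all
  then show ?thesis by (simp add: mult_ac)
qed

text \<open>If an end of the edge \<open>x y\<close> is strictly beyond some side of the triangle, then by
\<open>farey_noncrossing\<close> the other end is not strictly in front of it. Otherwise both ends are vertices
of the triangle, and any two vertices lie on a common side.\<close>

lemma farey_edge_beyond_side:
  assumes "lattice_basis p q" "lattice_basis x y"
  defines "r \<equiv> p + q"
  shows "\<exists>(a, b, c) \<in> {(p, q, r), (q, r, p), (r, p, q)}. \<forall>w\<in>{x, y}.
     orient (circ a) (circ b) (circ w) * orient (circ a) (circ b) (circ c) \<le> 0"
proof -
  define D where "D = cross2 p q"
  have D: "D * D = 1"
    using assms(1) by (auto simp: D_def lattice_basis_def abs_if split: if_splits)
  define m n where "m = (\<lambda>w. cross2 w q)" and "n = (\<lambda>w. cross2 p w)"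
  have nz: "p \<noteq> 0" "q \<noteq> 0" "r \<noteq> 0" "x \<noteq> 0" "y \<noteq> 0"
    using lattice_basis_nz[OF assms(1)] lattice_basis_nz[OF assms(2)] 
      lattice_basis_nz[OF lattice_basis_add[OF assms(1)]] by (auto simp: r_def)
  have side: "orient (circ a) (circ b) (circ w) * orient (circ a) (circ b) (circ c) \<le> 0"
    if "(cross2 b w * cross2 w a) * (cross2 b c * cross2 c a) \<le> 0" "a \<noteq> 0" "b \<noteq> 0" "c \<noteq> 0" "w \<noteq> 0"
    for a b c w
  proof -
    have "4 * (cross2 a b * cross2 b w * cross2 w a) * (4 * (cross2 a b * cross2 b c * cross2 c a)) =
      16 * (cross2 a b)\<^sup>2 * ((cross2 b w * cross2 w a) * (cross2 b c * cross2 c a))"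
      by (simp add: power2_eq_square)
    also have "\<dots> \<le> 0"
      using that(1) by (simp add: mult_nonneg_nonpos)
    finally show ?thesis
      using that(2-5)[THEN vec2_norm_nz[THEN iffD1]]
      unfolding orient_circ[OF that(2,3,4)] orient_circ[OF that(2,3,5)] times_divide_times_eq
      by (intro divide_nonpos_pos mult_pos_pos) simp_all
  qed
  have nonneg: "(m x * n x) * (m y * n y) \<ge> 0"
    "(m x * (m x - n x)) * (m y * (m y - n y)) \<ge> 0"
    "(n x * (n x - m x)) * (n y * (n y - m y)) \<ge> 0"
  proof -
    have qp: "lattice_basis q p" using assms(1) lattice_basis_commute by blast
    show "(m x * n x) * (m y * n y) \<ge> 0"
      unfolding m_def n_def by (rule farey_noncrossing[OF assms(1,2)])
    have eqs: "cross2 q w = - m w" "cross2 w (q + p) = m w - n w" "cross2 p w = n w" "cross2 w (p + q) = m w - n w" for w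
      by (simp_all add: m_def n_def cross2_linear cross2_swap[of w])
    show "(m x * (m x - n x)) * (m y * (m y - n y)) \<ge> 0"
      "(n x * (n x - m x)) * (n y * (n y - m y)) \<ge> 0"
      using farey_noncrossing[OF lattice_basis_add[OF qp] assms(2), unfolded eqs]
        farey_noncrossing[OF lattice_basis_add[OF assms(1)] assms(2), unfolded eqs]
      by (simp_all add: algebra_simps)
  qed
  \<comment> \<open>The position of a point relative to the three sides, normalized to be positive at the opposite vertex.\<close>
  define F where "F = (\<lambda>i w. if i = (0::nat) then m w * n w else if i = 1 then m w * (m w - n w) else n w * (n w - m w))"
  have vertex: "m w = 0 \<or> n w = 0 \<or> m w = n w" if "\<forall>i. F i w \<ge> 0" for w
  proof (rule ccontr)
    assume *: "\<not> ?thesis"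
    have "m w * n w \<ge> 0" "m w * (m w - n w) \<ge> 0" "n w * (n w - m w) \<ge> 0"
      using that[rule_format, of 0] that[rule_format, of 1] that[rule_format, of 2] by (simp_all add: F_def)
    with * show False by (auto simp: zero_le_mult_iff)
  qed
  have "\<exists>i\<in>{0,1,2}. F i x \<le> 0 \<and> F i y \<le> 0"
  proof (cases "(\<forall>i. F i x \<ge> 0) \<and> (\<forall>i. F i y \<ge> 0)")
    case True
    then have "m x = 0 \<or> n x = 0 \<or> m x = n x" "m y = 0 \<or> n y = 0 \<or> m y = n y"
      using vertex by blast+
    then show ?thesis by (auto simp: F_def)
  next
    case False
    then obtain i where "F i x < 0 \<or> F i y < 0" by (auto simp: not_le)
    moreover have "F i x * F i y \<ge> 0"
      using nonneg by (simp add: F_def)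
    ultimately have "F i x \<le> 0 \<and> F i y \<le> 0"
      by (smt (verit) mult_pos_neg mult_neg_pos)
    then have "F (if i = 0 then 0 else if i = 1 then 1 else 2) x \<le> 0 \<and> F (if i = 0 then 0 else if i = 1 then 1 else 2) y \<le> 0"
      by (auto simp: F_def)
    then show ?thesis by (metis insertCI)
  qed
  moreover have "cross2 q w * cross2 w p = F 0 w" "cross2 r w * cross2 w q = - F 1 w" "cross2 p w * cross2 w r = - F 2 w" for w
    by (simp_all add: F_def r_def m_def n_def cross2_linear cross2_swap[of w] algebra_simps)
  moreover have "F 0 r = 1" "F 1 p = 1" "F 2 q = 1"
    using D by (simp_all add: F_def r_def m_def n_def cross2_linear D_def)
  ultimately show ?thesis
    using side[of q _ p r] side[of r _ q p] side[of p _ r q] nz by auto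
qed

lemma farey_triangle_component:
  assumes "lattice_basis p q"
  defines "r \<equiv> p + q"
  shows "ideal_triangle (circ p) (circ q) (circ r) \<in> components (ball 0 1 - \<Union>farey)"
proof -
  have qp: "lattice_basis q p" using assms(1) lattice_basis_commute by blast
  have pr: "lattice_basis p r" and qr: "lattice_basis q r"
    using lattice_basis_add[OF assms(1)] lattice_basis_add[OF qp] by (simp_all add: r_def add.commute)
  have nz: "p \<noteq> 0" "q \<noteq> 0" "r \<noteq> 0"
    using lattice_basis_nz[OF pr] lattice_basis_nz[OF qr] by auto
  have "cross2 q r * cross2 r p \<noteq> 0" "cross2 p q \<noteq> 0"
    using assms by (auto simp: lattice_basis_def r_def cross2_linear cross2_swap[of q p])
  then have o: "orient (circ p) (circ q) (circ r) \<noteq> 0"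
    using nz by (auto simp: orient_circ[OF nz] vec2_eq_iff)
  have "ideal_triangle (circ p) (circ q) (circ r) \<inter> e = {}" if e: "e \<in> farey" for e
  proof -
    obtain x y where xy: "lattice_basis x y" "e = geodesic (circ x) (circ y)"
      using farey_edgeE[OF e] .
    obtain a b c where abc: "(a, b, c) \<in> {(p, q, r), (q, r, p), (r, p, q)}"
      "\<forall>w\<in>{x, y}. orient (circ a) (circ b) (circ w) * orient (circ a) (circ b) (circ c) \<le> 0"
      using farey_edge_beyond_side[OF assms(1) xy(1)] unfolding r_def by blast
    have "orient (circ a) (circ b) (circ c) \<noteq> 0"
      using abc(1) o orient_rotate[of "circ p" "circ q" "circ r"] orient_rotate[of "circ q" "circ r" "circ p"]
      by auto
    then have "ideal_triangle (circ a) (circ b) (circ c) \<inter> e = {}"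
      unfolding xy(2) using abc(2) by (intro ideal_triangle_disjoint_geodesic) auto
    moreover have "ideal_triangle (circ a) (circ b) (circ c) = ideal_triangle (circ p) (circ q) (circ r)"
      using abc(1) by (auto simp: ideal_triangle_def insert_commute)
    ultimately show ?thesis by simp
  qed
  moreover have "geodesic (circ p) (circ q) \<in> farey" "geodesic (circ q) (circ r) \<in> farey" "geodesic (circ r) (circ p) \<in> farey"
    using assms(1) pr qr lattice_basis_commute lattice_basis_edge_in_farey by blast+
  ultimately show ?thesis
    using lattice_basis_circ(1)[OF assms(1)] lattice_basis_circ(1)[OF qp] o nz
    by (intro ideal_triangle_component) (auto simp: norm_circ)
qed

lemma orient_frame:
  assumes "A \<in> SL2Z" "x \<noteq> 0 \<or> y \<noteq> 0" "x' \<noteq> 0 \<or> y' \<noteq> 0" "x'' \<noteq> 0 \<or> y'' \<noteq> 0"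
  shows "orient (edge_frame A x y) (edge_frame A x' y') (edge_frame A x'' y'') < 0 \<longleftrightarrow>
     (x * y' - y * x') * (x' * y'' - y' * x'') * (x'' * y - y'' * x) < 0"
proof -
  have nz: "matrix_inv A *v vector [x, y] \<noteq> 0" "matrix_inv A *v vector [x', y'] \<noteq> 0"
      "matrix_inv A *v vector [x'', y''] \<noteq> 0"
    using assms by (simp_all add: SL2Z_vector_nz matrix_inv_in_SL2Z vector2_nz)
  show ?thesis
    unfolding orient_circ[OF nz] cross2_matrix det_SL2Z[OF matrix_inv_in_SL2Z[OF assms(1)]]
    using nz[THEN vec2_norm_nz[THEN iffD1]]
    by (simp add: divide_less_0_iff cross2_def mult_less_0_iff zero_less_mult_iff not_less[symmetric] del: vec2_norm_nz)
qed

lemma frame_eq_iff: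
  assumes "A \<in> SL2Z" "x \<noteq> 0 \<or> y \<noteq> 0" "x' \<noteq> 0 \<or> y' \<noteq> 0"
  shows "edge_frame A x y = edge_frame A x' y' \<longleftrightarrow> x * y' = y * x'"
proof -
  have nz: "matrix_inv A *v vector [x, y] \<noteq> 0" "matrix_inv A *v vector [x', y'] \<noteq> 0"
    using assms by (simp_all add: SL2Z_vector_nz matrix_inv_in_SL2Z vector2_nz)
  show ?thesis
    unfolding circ_eq_iff[OF nz] cross2_matrix det_SL2Z[OF matrix_inv_in_SL2Z[OF assms(1)]]
    by (simp add: cross2_def)
qed

lemma norm_frame:
  assumes "A \<in> SL2Z" "x \<noteq> 0 \<or> y \<noteq> 0"
  shows "norm (edge_frame A x y) = 1"
  using assms by (simp add: norm_circ SL2Z_vector_nz matrix_inv_in_SL2Z vector2_nz)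

lemma frame_edge_in_farey:
  assumes "A \<in> SL2Z" "x \<in> \<int>" "y \<in> \<int>" "x' \<in> \<int>" "y' \<in> \<int>" "\<bar>x * y' - y * x'\<bar> = 1"
  shows "geodesic (edge_frame A x y) (edge_frame A x' y') \<in> farey"
  using frame_lattice_basis[OF assms] by (rule lattice_basis_edge_in_farey)

lemma has_clockwise_edges_ideal_triangle:
  "clockwise p q r \<Longrightarrow> has_clockwise_edges (ideal_triangle p q r) (geodesic p q, geodesic q r, geodesic r p)"
  unfolding has_clockwise_edges_def by blast

text \<open>For \<open>s = 1\<close> and \<open>s = -1\<close> these are the two triangles adjacent to the edge of \<open>A\<close>.\<close>

definition triangle_at :: "real^2^2 \<Rightarrow> real \<Rightarrow> complex set" where
  "triangle_at A s = ideal_triangle (edge_frame A 1 0) (edge_frame A 0 1) (edge_frame A 1 s)"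

text \<open>The two triangles lie on different sides of their common edge and traverse it in opposite
directions.\<close>

lemma triangle_at_clockwise_edges:
  assumes "A \<in> SL2Z"
  shows "has_clockwise_edges (triangle_at A 1)
      (edge A, geodesic (edge_frame A 1 0) (edge_frame A 1 1), geodesic (edge_frame A 1 1) (edge_frame A 0 1))"
    and "has_clockwise_edges (triangle_at A (-1))
      (edge A, geodesic (edge_frame A 0 1) (edge_frame A 1 (-1)), geodesic (edge_frame A 1 (-1)) (edge_frame A 1 0))"
proof -
  have "clockwise (edge_frame A 0 1) (edge_frame A 1 0) (edge_frame A 1 1)"
    "clockwise (edge_frame A 1 0) (edge_frame A 0 1) (edge_frame A 1 (-1))"
    using assms by (simp_all add: clockwise_iff_orient orient_frame norm_frame)
  note * = this[THEN has_clockwise_edges_ideal_triangle]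
  have 1: "triangle_at A 1 = ideal_triangle (edge_frame A 0 1) (edge_frame A 1 0) (edge_frame A 1 1)"
    by (simp add: triangle_at_def ideal_triangle_def insert_commute)
  show "has_clockwise_edges (triangle_at A 1)
      (edge A, geodesic (edge_frame A 1 0) (edge_frame A 1 1), geodesic (edge_frame A 1 1) (edge_frame A 0 1))"
    unfolding 1 edge_eq_frame[OF assms] geodesic_commute[of "edge_frame A 1 0" "edge_frame A 0 1"] by (rule *)
  show "has_clockwise_edges (triangle_at A (-1))
      (edge A, geodesic (edge_frame A 0 1) (edge_frame A 1 (-1)), geodesic (edge_frame A 1 (-1)) (edge_frame A 1 0))"
    unfolding triangle_at_def edge_eq_frame[OF assms] by (rule *)
qed

lemma triangle_at_distinct:
  assumes "A \<in> SL2Z"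
  shows "triangle_at A 1 \<noteq> triangle_at A (-1)"
proof
  assume *: "triangle_at A 1 = triangle_at A (-1)"
  let ?a = "edge_frame A 1 0" and ?b = "edge_frame A 0 1" and ?c = "edge_frame A 1 1" and ?d = "edge_frame A 1 (-1)"
  have "orient ?b ?a ?c < 0" "orient ?a ?b ?d < 0"
    using assms by (simp_all add: orient_frame)
  then have "orient ?a ?b ?c \<noteq> 0" "orient ?a ?b ?d \<noteq> 0"
    using orient_swap[of ?a ?b ?c] by auto
  then have "{?a, ?b, ?c} = {?a, ?b, ?d}"
    using * ideal_triangle_vertices[of ?a ?b ?c] ideal_triangle_vertices[of ?a ?b ?d] assms
    by (simp add: triangle_at_def norm_frame)
  then have "?c \<in> {?a, ?b, ?d}" by blast
  then show False
    using assms by (simp add: frame_eq_iff)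
qed

lemma triangle_at_in_farey_triangles:
  assumes "A \<in> SL2Z" "s = 1 \<or> s = -1"
  shows "triangle_at A s \<in> farey_triangles"
proof -
  have b: "lattice_basis (matrix_inv A *v vector [1, 0]) (matrix_inv A *v vector [0, s])"
    using assms by (intro frame_lattice_basis) auto
  have "matrix_inv A *v vector [1, 0] + matrix_inv A *v vector [0, s] = matrix_inv A *v vector [1, s]"
    by (simp add: vec2_eq_iff matrix_vector_nth2)
  moreover have "edge_frame A 0 s = edge_frame A 0 1"
    using assms by (auto simp: frame_eq_iff)
  ultimately have "triangle_at A s \<in> components (ball 0 1 - \<Union>farey)"
    using farey_triangle_component[OF b] by (simp add: triangle_at_def)
  moreover have "\<exists>a\<in>farey. \<exists>b\<in>farey. \<exists>c\<in>farey. has_clockwise_edges (triangle_at A s) (a, b, c)"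
  proof -
    have "edge A \<in> farey" using assms by (simp add: farey_def)
    moreover have "geodesic (edge_frame A 1 0) (edge_frame A 1 1) \<in> farey" 
      "geodesic (edge_frame A 1 1) (edge_frame A 0 1) \<in> farey"
      "geodesic (edge_frame A 0 1) (edge_frame A 1 (-1)) \<in> farey"
      "geodesic (edge_frame A 1 (-1)) (edge_frame A 1 0) \<in> farey"
      using assms by (simp_all add: frame_edge_in_farey)
    ultimately show ?thesis
      using triangle_at_clockwise_edges[OF assms(1)] assms(2) by blast
  qed
  ultimately show ?thesis by (simp add: farey_triangles_def)
qed

text \<open>Whatever the third vertex is, it is joined to both ends of the edge by Farey edges, which leaves the
two possibilities of \<open>farey_third_vertex\<close>.\<close>

lemma farey_triangle_at_edge:
  assumes "A \<in> SL2Z" "T \<in> farey_triangles" "has_clockwise_edges T (edge A, b, c)"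
  shows "T = triangle_at A 1 \<or> T = triangle_at A (-1)"
proof -
  obtain a' b' c' where f: "a' \<in> farey" "b' \<in> farey" "c' \<in> farey" "has_clockwise_edges T (a', b', c')"
    using assms(2) by (auto simp: farey_triangles_def)
  have "(edge A, b, c) \<in> {(a', b', c'), (b', c', a'), (c', a', b')}"
    by (rule has_clockwise_edges_unique[OF f(4) assms(3)])
  then have bc: "b \<in> farey" "c \<in> farey"
    using f by auto
  obtain P Q R where PQR: "clockwise P Q R" "T = ideal_triangle P Q R"
     "edge A = geodesic P Q" "b = geodesic Q R" "c = geodesic R P"
    using assms(3) by (auto simp: has_clockwise_edges_def)
  let ?p = "matrix_inv A *v vector [1, 0]" and ?q = "matrix_inv A *v vector [0, 1]"
  have basis: "lattice_basis ?p ?q"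
    using assms(1) by (simp add: frame_lattice_basis)
  then have basis': "lattice_basis ?q ?p" using lattice_basis_commute by blast
  have PQR_circle: "P \<in> circle" "Q \<in> circle" "R \<in> circle"
    using PQR(1) unfolding clockwise_iff_orient by blast+
  have ne: "P \<noteq> Q" "Q \<noteq> R" "R \<noteq> P"
    using PQR(1) by (auto simp: clockwise_iff_orient orient_degenerate)
  have "{P, Q} = {circ ?p, circ ?q}"
    using PQR(3) edge_eq_frame[OF assms(1)] PQR_circle ne(1) 
      lattice_basis_circ[OF basis] lattice_basis_circ[OF basis'] geodesic_eq_iff by metis
  then have PQ: "P = circ ?p \<and> Q = circ ?q \<or> P = circ ?q \<and> Q = circ ?p"
    by (auto simp: doubleton_eq_iff)
  then have "geodesic (circ ?q) R \<in> farey \<and> geodesic R (circ ?p) \<in> farey \<and> R \<noteq> circ ?p \<and> R \<noteq> circ ?q"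
    using bc PQR(4,5) ne geodesic_commute by metis
  then have "R = circ (?p + ?q) \<or> R = circ (?p - ?q)"
    using farey_third_vertex[OF basis] PQR_circle(3) by blast
  moreover have "?p + ?q = matrix_inv A *v vector [1, 1]" "?p - ?q = matrix_inv A *v vector [1, -1]"
    by (simp_all add: vec2_eq_iff matrix_vector_nth2)
  moreover have "T = ideal_triangle (circ ?p) (circ ?q) R"
    using PQ PQR(2) by (auto simp: ideal_triangle_def insert_commute)
  ultimately show ?thesis
    by (auto simp: triangle_at_def)
qed

section \<open>One-sided values of wavelets\<close>

text \<open>The matrix \<open>w w\<^sup>T J\<close> with \<open>J\<close> the standard symplectic matrix. It is nilpotent with
kernel spanned by \<open>w\<close>, and its trace against \<open>X\<close> is, up to a factor, the vector field of \<open>X\<close> at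
\<open>circ w\<close>.\<close>

definition parabolic :: "real^2 \<Rightarrow> real^2^2" where
  "parabolic w = mat2 (- (w$1 * w$2)) ((w$1)\<^sup>2) (- (w$2)\<^sup>2) (w$1 * w$2)"

lemma parabolic_parallelogram:
  "4 *\<^sub>R parabolic p + 4 *\<^sub>R parabolic q - 2 *\<^sub>R parabolic (p + q) - 2 *\<^sub>R parabolic (p - q) = 0"
  by (simp add: mat22_eq_iff parabolic_def power2_eq_square algebra_simps)

lemma parabolic_scale: "parabolic (k *\<^sub>R w) = k\<^sup>2 *\<^sub>R parabolic w"
  by (simp add: mat22_eq_iff parabolic_def power2_eq_square)

lemma trace_parabolic_parabolic: "trace (parabolic w ** parabolic w) = 0"
  by (simp add: trace_2 matrix_matrix_nth2 parabolic_def power2_eq_square)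

text \<open>Matrices of determinant one preserve the symplectic form.\<close>

lemma parabolic_conjugate:
  assumes "A \<in> SL2Z"
  shows "matrix_inv A ** parabolic (A *v w) ** A = parabolic w"
proof -
  define a b c d x y where abcd: "a = A$1$1" "b = A$1$2" "c = A$2$1" "d = A$2$2" "x = w$1" "y = w$2"
  have det: "a * d = 1 + b * c"
    using assms by (simp add: SL2Z_def det_2 abcd)
  show ?thesis
    unfolding mat22_eq_iff matrix_matrix_nth2 matrix_inv_SL2Z[OF assms] parabolic_def mat2_nth matrix_vector_nth2
    unfolding abcd[symmetric]
    using det by (intro conjI; algebra)
qed

lemma trace_add_mult:
  "trace ((X + Y) ** Z) = trace (X ** Z) + trace (Y ** Z)"
  "trace (Z ** (X + Y)) = trace (Z ** X) + trace (Z ** Y)"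
  "trace ((X - Y) ** Z) = trace (X ** Z) - trace (Y ** Z)"
  "trace (Z ** (X - Y)) = trace (Z ** X) - trace (Z ** Y)"
  "trace ((k *\<^sub>R X) ** Z) = k * trace (X ** Z)"
  "trace (Z ** (k *\<^sub>R X)) = k * trace (Z ** X)"
  for X Y Z :: "real^2^2"
  by (simp_all add: trace_2 matrix_matrix_nth2 algebra_simps)

lemma trace_sum_mult:
  "trace (sum f S ** Z) = (\<Sum>i\<in>S. trace (f i ** Z))"
  "trace (Z ** sum f S) = (\<Sum>i\<in>S. trace (Z ** f i))"
  for Z :: "real^2^2"
  by (induction S rule: infinite_finite_induct; simp add: trace_add_mult; simp add: trace_2 matrix_matrix_nth2)+

lemma mother_circ:
  assumes "w \<noteq> 0"
  shows "mother (circ w) =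
     (if (w$1 - w$2) * (w$1 + w$2) > 0 \<and> w$1 * w$2 \<le> 0 then sl2_h + 2 *\<^sub>R sl2_e
      else if (w$1 - w$2) * (w$1 + w$2) \<le> 0 \<and> w$1 * w$2 < 0 then - sl2_h + 2 *\<^sub>R sl2_f
      else if (w$1 - w$2) * (w$1 + w$2) < 0 \<and> w$1 * w$2 \<ge> 0 then - sl2_h - 2 *\<^sub>R sl2_f
      else sl2_h - 2 *\<^sub>R sl2_e)"
proof -
  define n where "n = (w$1)\<^sup>2 + (w$2)\<^sup>2"
  have n: "n > 0" using assms unfolding n_def by (rule vec2_norm_nz[THEN iffD1])
  have R: "Re (circ w) = (w$1 - w$2) * (w$1 + w$2) / n" 
    by (simp add: Re_circ n_def power2_eq_square algebra_simps)
  have I: "Im (circ w) = (- 2) * (w$1 * w$2) / n"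
    by (simp add: Im_circ n_def)
  have sgn_div: "x / n > 0 \<longleftrightarrow> x > 0" "x / n < 0 \<longleftrightarrow> x < 0" "x / n \<le> 0 \<longleftrightarrow> x \<le> 0" "x / n \<ge> 0 \<longleftrightarrow> x \<ge> 0" for x
    using n by (simp_all add: field_simps)
  have "Re (circ w) > 0 \<longleftrightarrow> (w$1 - w$2) * (w$1 + w$2) > 0" "Re (circ w) < 0 \<longleftrightarrow> (w$1 - w$2) * (w$1 + w$2) < 0"
    "Re (circ w) \<le> 0 \<longleftrightarrow> (w$1 - w$2) * (w$1 + w$2) \<le> 0"
    "Im (circ w) > 0 \<longleftrightarrow> w$1 * w$2 < 0" "Im (circ w) \<ge> 0 \<longleftrightarrow> w$1 * w$2 \<le> 0" "Im (circ w) \<le> 0 \<longleftrightarrow> w$1 * w$2 \<ge> 0"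
    unfolding R I sgn_div by linarith+
  then show ?thesis
    unfolding mother_def by simp
qed

lemma sgn_eqI: "x \<noteq> 0 \<Longrightarrow> (x > 0 \<longrightarrow> y > 0) \<Longrightarrow> (x < 0 \<longrightarrow> y < 0) \<Longrightarrow> sgn y = sgn x" for x y :: real
  by (auto simp: sgn_if)

lemma mother_circ_cong_sgn:
  assumes "w \<noteq> 0" "w' \<noteq> 0" "sgn (w'$1) = sgn (w$1)" "sgn (w'$2) = sgn (w$2)"
    "sgn (w'$1 - w'$2) = sgn (w$1 - w$2)" "sgn (w'$1 + w'$2) = sgn (w$1 + w$2)"
  shows "mother (circ w') = mother (circ w)"
proof -
  have "x > 0 \<longleftrightarrow> sgn x = 1" "x < 0 \<longleftrightarrow> sgn x = -1" "x \<le> 0 \<longleftrightarrow> sgn x \<noteq> 1" "x \<ge> 0 \<longleftrightarrow> sgn x \<noteq> -1" for x :: real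
    by (auto simp: sgn_if)
  then show ?thesis
    unfolding mother_circ[OF assms(1)] mother_circ[OF assms(2)] by (simp only: sgn_mult assms(3-))
qed

text \<open>The jump of the mother wavelet at \<open>circ w\<close> is \<open>step_weight w\<close> times \<open>parabolic w\<close>. Dividing by the
squared length makes this product independent of the choice of \<open>w\<close>. At the integer vectors
\<open>(1, 0)\<close>, \<open>(0, 1)\<close>, \<open>(1, 1)\<close>, \<open>(1, -1)\<close> the weights are \<open>4, 4, -2, -2\<close>.\<close>

definition step_weight :: "real^2 \<Rightarrow> real" where
  "step_weight w = (if w$1 * w$2 = 0 then 4 else if \<bar>w$1\<bar> = \<bar>w$2\<bar> then - 4 else 0) / ((w$1)\<^sup>2 + (w$2)\<^sup>2)"

lemma step_weight_scale:
  assumes "k \<noteq> 0"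
  shows "step_weight (k *\<^sub>R w) = step_weight w / k\<^sup>2"
  using assms by (simp add: step_weight_def abs_mult power_mult_distrib flip: distrib_left)

text \<open>The quadrants of the circle correspond to the sectors between the two coordinate axes and the two
diagonals. The relation says that passing from \<open>w\<close> to \<open>w'\<close> crosses none of these lines, although it
may leave a line on which \<open>w\<close> lies. It holds whenever \<open>w'\<close> is close enough to \<open>w\<close>.\<close>

definition keeps_sides :: "real^2 \<Rightarrow> real^2 \<Rightarrow> bool" where
  "keeps_sides w w' \<longleftrightarrow> (\<forall>(x, y) \<in> {(1, 0), (0, 1), (1, 1), (1, -1)}.
     (x * w$1 + y * w$2 > 0 \<longrightarrow> x * w'$1 + y * w'$2 > 0) \<and>
     (x * w$1 + y * w$2 < 0 \<longrightarrow> x * w'$1 + y * w'$2 < 0))"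

text \<open>For close vectors, a negative determinant means that \<open>circ w'\<close> comes after \<open>circ w\<close> in the counter-clockwise direction.
Each quadrant contains its initial point, so there is no change in this direction.\<close>

lemma mother_slightly_beyond:
  assumes "w \<noteq> 0" "keeps_sides w w'" "cross2 w w' < 0"
  shows "mother (circ w') = mother (circ w)"
proof -
  define a b c d where abcd: "a = w$1" "b = w$2" "c = w'$1" "d = w'$2"
  have "w' \<noteq> 0" using assms(3) by (auto simp: cross2_def)
  have s: "b > 0 \<longrightarrow> d > 0" "b < 0 \<longrightarrow> d < 0" "a > 0 \<longrightarrow> c > 0" "a < 0 \<longrightarrow> c < 0"
    "a - b > 0 \<longrightarrow> c - d > 0" "a - b < 0 \<longrightarrow> c - d < 0"
    "a + b > 0 \<longrightarrow> c + d > 0" "a + b < 0 \<longrightarrow> c + d < 0"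
    using assms(2) by (simp_all add: keeps_sides_def abcd)
  have cr: "a * d < b * c" using assms(3) by (simp add: cross2_def abcd)
  have "a \<noteq> 0 \<or> b \<noteq> 0" using assms(1) by (simp add: vec2_eq_iff abcd)
  then consider "a = 0" "b \<noteq> 0" | "b = 0" "a \<noteq> 0" | "a \<noteq> 0" "b = a" | "a \<noteq> 0" "b = - a" | "a \<noteq> 0" "b \<noteq> 0" "b \<noteq> a" "b \<noteq> - a"
    by blast
  then show ?thesis
  proof cases
    case 5
    show ?thesis
      unfolding abcd
      by (intro mother_circ_cong_sgn sgn_eqI \<open>w \<noteq> 0\<close> \<open>w' \<noteq> 0\<close> s[unfolded abcd]) (use 5 in \<open>simp_all add: abcd add_eq_0_iff2\<close>)
  next
    case 1 then show ?thesis
      unfolding mother_circ[OF \<open>w \<noteq> 0\<close>] mother_circ[OF \<open>w' \<noteq> 0\<close>] abcd[symmetric]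
      using s cr by (cases "b > 0") (auto simp: zero_less_mult_iff mult_less_0_iff mult_le_0_iff zero_le_mult_iff)
  next
    case 2 then show ?thesis
      unfolding mother_circ[OF \<open>w \<noteq> 0\<close>] mother_circ[OF \<open>w' \<noteq> 0\<close>] abcd[symmetric]
      using s cr by (cases "a > 0") (auto simp: zero_less_mult_iff mult_less_0_iff mult_le_0_iff zero_le_mult_iff)
  next
    case 3 
    then have "a * (c - d) > 0" using cr by (simp add: algebra_simps)
    then show ?thesis using 3
      unfolding mother_circ[OF \<open>w \<noteq> 0\<close>] mother_circ[OF \<open>w' \<noteq> 0\<close>] abcd[symmetric]
      using s by (cases "a > 0") (auto simp: zero_less_mult_iff mult_less_0_iff mult_le_0_iff zero_le_mult_iff)
  next
    case 4 
    then have "a * (c + d) < 0" using cr by (simp add: algebra_simps)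
    then show ?thesis using 4
      unfolding mother_circ[OF \<open>w \<noteq> 0\<close>] mother_circ[OF \<open>w' \<noteq> 0\<close>] abcd[symmetric]
      using s by (cases "a > 0") (auto simp: zero_less_mult_iff mult_less_0_iff mult_le_0_iff zero_le_mult_iff)
  qed
qed

text \<open>In the clockwise direction the initial point of a quadrant is adjacent to the preceding quadrant, whose
matrix differs from that of its own quadrant by a parabolic one.\<close>

lemma mother_slightly_before:
  assumes "w \<noteq> 0" "keeps_sides w w'" "cross2 w w' > 0"
  shows "mother (circ w') = mother (circ w) - step_weight w *\<^sub>R parabolic w"
proof -
  define a b c d where abcd: "a = w$1" "b = w$2" "c = w'$1" "d = w'$2"
  have "w' \<noteq> 0" using assms(3) by (auto simp: cross2_def)
  have s: "b > 0 \<longrightarrow> d > 0" "b < 0 \<longrightarrow> d < 0" "a > 0 \<longrightarrow> c > 0" "a < 0 \<longrightarrow> c < 0"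
    "a - b > 0 \<longrightarrow> c - d > 0" "a - b < 0 \<longrightarrow> c - d < 0"
    "a + b > 0 \<longrightarrow> c + d > 0" "a + b < 0 \<longrightarrow> c + d < 0"
    using assms(2) by (simp_all add: keeps_sides_def abcd)
  have cr: "a * d > b * c" using assms(3) by (simp add: cross2_def abcd)
  note eqs = mother_circ[OF \<open>w \<noteq> 0\<close>] mother_circ[OF \<open>w' \<noteq> 0\<close>] mat22_eq_iff parabolic_def step_weight_def
     sl2_e_def sl2_f_def sl2_h_def
  note signs = zero_less_mult_iff mult_less_0_iff mult_le_0_iff zero_le_mult_iff
  have "a \<noteq> 0 \<or> b \<noteq> 0" using assms(1) by (simp add: vec2_eq_iff abcd)
  then consider "a = 0" "b \<noteq> 0" | "b = 0" "a \<noteq> 0" | "a \<noteq> 0" "b = a" | "a \<noteq> 0" "b = - a" | "a \<noteq> 0" "b \<noteq> 0" "b \<noteq> a" "b \<noteq> - a"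
    by blast
  then show ?thesis
  proof cases
    case 5
    have "mother (circ w') = mother (circ w)"
      unfolding abcd
      by (intro mother_circ_cong_sgn sgn_eqI \<open>w \<noteq> 0\<close> \<open>w' \<noteq> 0\<close> s[unfolded abcd]) (use 5 in \<open>simp_all add: abcd add_eq_0_iff2\<close>)
    moreover have "step_weight w = 0"
      using 5 by (auto simp: step_weight_def abcd[symmetric] abs_eq_iff)
    ultimately show ?thesis by simp
  next
    case 1 then show ?thesis
      unfolding eqs abcd[symmetric]
      using s cr by (cases "b > 0") (auto simp: signs)
  next
    case 2 then show ?thesis
      unfolding eqs abcd[symmetric]
      using s cr by (cases "a > 0") (auto simp: signs)
  next
    case 3 
    then have "a * (c - d) < 0" using cr by (simp add: algebra_simps)
    then show ?thesis using 3
      unfolding eqs abcd[symmetric]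
      using s by (cases "a > 0") (auto simp: signs power2_eq_square)
  next
    case 4 
    then have "a * (c + d) > 0" using cr by (simp add: algebra_simps)
    then show ?thesis using 4
      unfolding eqs abcd[symmetric]
      using s by (cases "a > 0") (auto simp: signs power2_eq_square)
  qed
qed

lemma eventually_keeps_sides:
  assumes "(g \<longlongrightarrow> w) F"
  shows "\<forall>\<^sub>F t in F. keeps_sides w (g t)"
proof -
  have ev: "\<forall>\<^sub>F t in F. (x * w$1 + y * w$2 > 0 \<longrightarrow> x * g t$1 + y * g t$2 > 0) \<and>
      (x * w$1 + y * w$2 < 0 \<longrightarrow> x * g t$1 + y * g t$2 < 0)" for x y
  proof -
    have "((\<lambda>t. x * g t$1 + y * g t$2) \<longlongrightarrow> x * w$1 + y * w$2) F"
      by (intro tendsto_intros assms)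
    then show ?thesis
      by (cases "x * w$1 + y * w$2" "0::real" rule: linorder_cases) (auto dest: order_tendstoD)
  qed
  then show ?thesis
    unfolding keeps_sides_def using ev[of 1 0] ev[of 0 1] ev[of 1 1] ev[of 1 "-1"]
    by (intro eventually_ball_finite) simp_all
qed

definition wavelet_jump :: "real^2^2 \<Rightarrow> complex \<Rightarrow> real^2^2" where
  "wavelet_jump A z = step_weight (A *v half_angle (Arg z)) *\<^sub>R parabolic (half_angle (Arg z))"

lemma wavelet_jump_circ:
  assumes "w \<noteq> 0"
  shows "wavelet_jump A (circ w) = step_weight (A *v w) *\<^sub>R parabolic w"
proof -
  define w' where "w' = half_angle (Arg (circ w))"
  have "norm (circ w) = 1" using assms by (rule norm_circ)
  then have "circ w' = circ w"
    unfolding w'_def circ_half_angle using cis_Arg[of "circ w"] by (force simp: sgn_eq)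
  then have "cross2 w' w = 0"
    using assms circ_eq_iff half_angle_nz unfolding w'_def by blast
  moreover have "w' \<noteq> 0" unfolding w'_def by (rule half_angle_nz)
  moreover obtain k where k: "w = k *\<^sub>R w'"
  proof (cases "w'$1 = 0")
    case True
    then show ?thesis using \<open>cross2 w' w = 0\<close> \<open>w' \<noteq> 0\<close>
      by (intro that[of "w$2 / w'$2"]) (auto simp: vec2_eq_iff cross2_def)
  next
    case False
    then show ?thesis using \<open>cross2 w' w = 0\<close>
      by (intro that[of "w$1 / w'$1"]) (auto simp: vec2_eq_iff cross2_def field_simps)
  qed
  ultimately have "k \<noteq> 0" using assms by auto
  then show ?thesis
    unfolding wavelet_jump_def w'_def[symmetric] unfolding k
    by (simp add: parabolic_scale step_weight_scale matrix_vector_mult_scaleR)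
qed

text \<open>The path \<open>A *v half_angle t\<close> turns in the same direction for every \<open>A\<close>, because \<open>A\<close> has determinant
one. So the one-sided values of every wavelet follow from those of the mother wavelet.\<close>

lemma wavelet_one_sided:
  assumes "A \<in> SL2Z"
  shows "\<forall>\<^sub>F t in at_right s. wavelet A (cis t) = wavelet A (cis s)"
    and "\<forall>\<^sub>F t in at_left s. wavelet A (cis t) = wavelet A (cis s) - wavelet_jump A (cis s)"
proof -
  define g where "g t = A *v half_angle t" for t
  have nz: "g t \<noteq> 0" for t
    using assms by (simp add: g_def SL2Z_vector_nz half_angle_nz)
  have wav: "wavelet A (cis t) = matrix_inv A ** mother (circ (g t)) ** A" for t
    using wavelet_circ[OF assms half_angle_nz[of t]] by (simp add: circ_half_angle g_def)
  have lim: "(g \<longlongrightarrow> g s) (at s within S)" for S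
    unfolding g_def half_angle_def
    by (rule vec_tendstoI) (auto simp: forall_2 matrix_vector_mult_def sum_2 exhaust_2 intro!: tendsto_eq_intros)
  have cr: "cross2 (g s) (g t) = - sin ((t - s) / 2)" for t
    unfolding g_def cross2_matrix det_SL2Z[OF assms] by (simp add: cross2_half_angle)
  have "\<forall>\<^sub>F t in at_right s. t \<in> {s<..<s+1}"
    by (rule eventually_at_right_real) simp
  then have "\<forall>\<^sub>F t in at_right s. cross2 (g s) (g t) < 0"
  proof eventually_elim
    case (elim t)
    then have "sin ((t - s) / 2) > 0" using pi_gt3 by (intro sin_gt_zero) auto
    then show ?case by (simp add: cr)
  qed
  with eventually_keeps_sides[OF lim]
  show "\<forall>\<^sub>F t in at_right s. wavelet A (cis t) = wavelet A (cis s)"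
  proof eventually_elim
    case (elim t)
    then show ?case using mother_slightly_beyond[OF nz] by (simp add: wav)
  qed
  have "\<forall>\<^sub>F t in at_left s. t \<in> {s-1<..<s}"
    by (rule eventually_at_left_real) simp
  then have "\<forall>\<^sub>F t in at_left s. cross2 (g s) (g t) > 0"
  proof eventually_elim
    case (elim t)
    then have "sin ((s - t) / 2) > 0" using pi_gt3 by (intro sin_gt_zero) auto
    moreover have "(t - s) / 2 = - ((s - t) / 2)"
      by (simp only: minus_divide_left minus_diff_eq)
    ultimately show ?case by (simp only: cr sin_minus minus_minus)
  qed
  with eventually_keeps_sides[OF lim]
  show "\<forall>\<^sub>F t in at_left s. wavelet A (cis t) = wavelet A (cis s) - wavelet_jump A (cis s)"
  proof eventually_elim
    case (elim t)
    have "wavelet A (cis t) = matrix_inv A ** (mother (circ (g s)) - step_weight (g s) *\<^sub>R parabolic (g s)) ** A"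
      using mother_slightly_before[OF nz elim] by (simp add: wav)
    also have "\<dots> = wavelet A (cis s) - step_weight (g s) *\<^sub>R (matrix_inv A ** parabolic (g s) ** A)"
      by (simp add: wav mat22_eq_iff matrix_matrix_nth2 algebra_simps)
    also have "matrix_inv A ** parabolic (g s) ** A = parabolic (half_angle s)"
      unfolding g_def by (rule parabolic_conjugate[OF assms])
    also have "step_weight (g s) *\<^sub>R parabolic (half_angle s) = wavelet_jump A (cis s)"
      using wavelet_jump_circ[OF half_angle_nz, of A s] by (simp add: circ_half_angle g_def)
    finally show ?case .
  qed
qed

section \<open>The pairing of two wavelets\<close>

text \<open>Up to a factor, the value of the mother wavelet at \<open>circ w\<close> as a vector field, made homogeneous of
degree two in the coordinates.\<close>

definition mother_value :: "real^2 \<Rightarrow> real" where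
  "mother_value w = trace (mother (circ w) ** parabolic w)"

lemma wavelet_value:
  assumes "A \<in> SL2Z" "w \<noteq> 0"
  shows "trace (wavelet A (circ w) ** parabolic w) = mother_value (A *v w)"
proof -
  have *: "A ** parabolic w ** matrix_inv A = parabolic (A *v w)"
    using parabolic_conjugate[OF assms(1), of w, symmetric] matrix_inv_mult_SL2Z[OF assms(1)]
    by (simp add: matrix_mul_assoc)
       (simp add: matrix_mul_assoc[symmetric])
  have "trace (wavelet A (circ w) ** parabolic w) =
     trace (matrix_inv A ** (mother (circ (A *v w)) ** A ** parabolic w))"
    by (simp add: wavelet_circ[OF assms] matrix_mul_assoc)
  also have "\<dots> = trace ((mother (circ (A *v w)) ** A ** parabolic w) ** matrix_inv A)"
    by (rule trace_mul_sym)
  also have "\<dots> = trace (mother (circ (A *v w)) ** (A ** parabolic w ** matrix_inv A))"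
    by (simp add: matrix_mul_assoc)
  finally show ?thesis
    by (simp add: mother_value_def *)
qed

text \<open>The breakpoints of the mother wavelet.\<close>

abbreviation corner_vectors :: "(real^2) set" where
  "corner_vectors \<equiv> {vector [1, 0], vector [0, 1], vector [1, 1], vector [1, -1]}"

text \<open>The cones over the four quadrants of the circle, each given by the lattice basis that spans it.\<close>

abbreviation quadrant_cones :: "((real^2) \<times> (real^2)) set" where
  "quadrant_cones \<equiv> {(vector [1, 0], vector [1, 1]), (vector [1, 1], vector [0, 1]),
     (vector [0, 1], vector [-1, 1]), (vector [-1, 1], vector [-1, 0])}"

text \<open>The product of the coordinates of \<open>w\<close> in the basis \<open>v, v'\<close> when this has determinant one. It is
positive exactly inside the cone spanned by the basis and the opposite cone.\<close>

definition cone_form :: "real^2 \<Rightarrow> real^2 \<Rightarrow> real^2 \<Rightarrow> real" where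
  "cone_form v v' w = cross2 w v' * cross2 v w"

text \<open>The parallelogram law, valid for any quadratic form.\<close>

lemma cone_form_parallelogram:
  "4 * cone_form v v' p + 4 * cone_form v v' q - 2 * cone_form v v' (p + q) - 2 * cone_form v v' (p - q) = 0"
  by (simp add: cone_form_def cross2_linear algebra_simps)

text \<open>Changing signs, one may take all entries nonnegative and those of the first vector positive. Two such
vectors with determinant \<open>\<plusminus>1\<close> are comparable in the componentwise order: if, say, \<open>x > z\<close> and \<open>y < u\<close>, then \<open>x u\<close> exceeds \<open>y z\<close> by at
least \<open>y + z + 1\<close>. Hence sum and difference stay in the cone of vectors with entries of equal sign.\<close>

lemma Ints_unimodular_nonneg:
  fixes a b c d :: real
  assumes Z: "a \<in> \<int>" "b \<in> \<int>" "c \<in> \<int>" "d \<in> \<int>" and det: "\<bar>a * d - b * c\<bar> = 1"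
    and nonneg: "a * b > 0" "c * d \<ge> 0"
  shows "(a + c) * (b + d) \<ge> 0" "(a - c) * (b - d) \<ge> 0"
proof -
  obtain i j k l where ijkl: "a = of_int i" "b = of_int j" "c = of_int k" "d = of_int l"
    using Z by (auto elim!: Ints_cases)
  have "of_int \<bar>i * l - j * k\<bar> = (1::real)" using det by (simp add: ijkl)
  then have det': "\<bar>i * l - j * k\<bar> = 1" by linarith
  have pos: "i * j > 0" "k * l \<ge> 0"
    using nonneg unfolding ijkl by (simp_all flip: of_int_mult)
  have key: "(x + z) * (y + u) \<ge> 0 \<and> (x - z) * (y - u) \<ge> 0"
    if "\<bar>x * u - y * z\<bar> = 1" "x > 0" "y > 0" "z \<ge> 0" "u \<ge> 0" for x y z u :: int
  proof -
    have "\<not> (x > z \<and> y < u)"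
    proof
      assume "x > z \<and> y < u"
      then have "(z + 1) * (y + 1) \<le> x * u" using that by (intro mult_mono) auto
      then have "x * u - y * z \<ge> 1 + y + z" by (simp add: algebra_simps)
      then show False using that by linarith
    qed
    moreover have "\<not> (x < z \<and> y > u)"
    proof
      assume "x < z \<and> y > u"
      then have "(u + 1) * (x + 1) \<le> y * z" using that by (intro mult_mono) auto
      then have "y * z - x * u \<ge> 1 + x + u" by (simp add: algebra_simps)
      then show False using that by linarith
    qed
    ultimately have "(x - z) * (y - u) \<ge> 0"
      by (auto simp: zero_le_mult_iff)
    then show ?thesis using that by simp
  qed
  have "(i + k) * (j + l) \<ge> 0 \<and> (i - k) * (j - l) \<ge> 0"
  proof (cases "i > 0")
    case True
    then have "j > 0" using pos by (simp add: zero_less_mult_iff)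
    show ?thesis
    proof (cases "k \<ge> 0 \<and> l \<ge> 0")
      case True
      then show ?thesis using key[of i l j k] det' \<open>i > 0\<close> \<open>j > 0\<close> by simp
    next
      case False
      then have "k \<le> 0" "l \<le> 0" using pos(2) by (auto simp: zero_le_mult_iff)
      then show ?thesis using key[of i "-l" j "-k"] det' \<open>i > 0\<close> \<open>j > 0\<close> by (simp add: abs_minus_commute)
    qed
  next
    case False
    then have "i < 0" "j < 0" using pos by (auto simp: zero_less_mult_iff)
    show ?thesis
    proof (cases "k \<ge> 0 \<and> l \<ge> 0")
      case True
      then show ?thesis using key[of "-i" l "-j" k] det' \<open>i < 0\<close> \<open>j < 0\<close>
        by (auto simp: abs_minus_commute zero_le_mult_iff)
    next
      case False
      then have "k \<le> 0" "l \<le> 0" using pos(2) by (auto simp: zero_le_mult_iff)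
      then show ?thesis using key[of "-i" "-l" "-j" "-k"] det' \<open>i < 0\<close> \<open>j < 0\<close>
        by (auto simp: abs_minus_commute zero_le_mult_iff)
    qed
  qed
  then have "of_int ((i + k) * (j + l)) \<ge> (0::real)" "of_int ((i - k) * (j - l)) \<ge> (0::real)"
    by (simp_all only: of_int_0_le_iff)
  then show "(a + c) * (b + d) \<ge> 0" "(a - c) * (b - d) \<ge> 0"
    by (simp_all add: ijkl)
qed

text \<open>If one end of a Farey edge is inside a cone, then the edge does not cross the edge that spans the
cone, and the whole quadrilateral of the first edge remains in the closed cone.\<close>

lemma lattice_basis_in_cone:
  assumes "lattice_basis v v'" "lattice_basis p q" "cone_form v v' p > 0"
  shows "cone_form v v' q \<ge> 0" "cone_form v v' (p + q) \<ge> 0" "cone_form v v' (p - q) \<ge> 0"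
proof -
  have "cone_form v v' p * cone_form v v' q \<ge> 0"
    using farey_noncrossing[OF assms(1,2)] by (simp add: cone_form_def)
  then show q: "cone_form v v' q \<ge> 0"
    using assms(3) by (simp add: zero_le_mult_iff)
  have "cross2 p v' * cross2 v q - cross2 v p * cross2 q v' = cross2 v v' * cross2 p q"
    by (simp add: cross2_def algebra_simps)
  then have d: "\<bar>cross2 p v' * cross2 v q - cross2 v p * cross2 q v'\<bar> = 1"
    using assms by (simp add: lattice_basis_def abs_mult)
  have Z: "cross2 p v' \<in> \<int>" "cross2 v p \<in> \<int>" "cross2 q v' \<in> \<int>" "cross2 v q \<in> \<int>"
    using assms by (auto simp: lattice_basis_def cross2_def)
  show "cone_form v v' (p + q) \<ge> 0" "cone_form v v' (p - q) \<ge> 0"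
    using Ints_unimodular_nonneg[OF Z d] assms(3) q
    by (simp_all add: cone_form_def cross2_linear)
qed

lemma mother_value_minus: "mother_value (- w) = mother_value w"
  using circ_scale[of "-1" w] parabolic_scale[of "-1" w] by (simp add: mother_value_def)

text \<open>On each cone the mother wavelet is one matrix, whose vector field vanishes at the two breakpoints
that bound the cone. This determines its quadratic form up to a factor, and the factors alternate.\<close>

lemma mother_value_cone:
  assumes "w \<noteq> 0"
  shows "cone_form (vector [1, 0]) (vector [1, 1]) w \<ge> 0 \<Longrightarrow> mother_value w = - 2 * cone_form (vector [1, 0]) (vector [1, 1]) w"
    and "cone_form (vector [1, 1]) (vector [0, 1]) w \<ge> 0 \<Longrightarrow> mother_value w = 2 * cone_form (vector [1, 1]) (vector [0, 1]) w"
    and "cone_form (vector [0, 1]) (vector [-1, 1]) w \<ge> 0 \<Longrightarrow> mother_value w = - 2 * cone_form (vector [0, 1]) (vector [-1, 1]) w"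
    and "cone_form (vector [-1, 1]) (vector [-1, 0]) w \<ge> 0 \<Longrightarrow> mother_value w = 2 * cone_form (vector [-1, 1]) (vector [-1, 0]) w"
proof -
  define a b where ab: "a = w$1" "b = w$2"
  define P R where PR: "P = (a - b) * (a + b)" "R = a * b"
  have val: "mother_value w = (if P > 0 \<and> R \<le> 0 then - 2 * b * (a + b)
      else if P \<le> 0 \<and> R < 0 then 2 * a * (a + b)
      else if P < 0 \<and> R \<ge> 0 then - 2 * a * (a - b)
      else - 2 * b * (a - b))"
    unfolding mother_value_def mother_circ[OF assms] ab[symmetric] PR[symmetric]
    by (simp add: trace_2 matrix_matrix_nth2 parabolic_def sl2_e_def sl2_f_def sl2_h_def ab[symmetric] power2_eq_square algebra_simps)
  have nz: "a \<noteq> 0 \<or> b \<noteq> 0" using assms by (simp add: vec2_eq_iff ab)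
  have sq: "0 < x * x \<longleftrightarrow> x \<noteq> 0" for x :: real
    by (auto simp: zero_less_mult_iff)
  note signs = zero_less_mult_iff mult_less_0_iff mult_le_0_iff zero_le_mult_iff
  show "mother_value w = - 2 * cone_form (vector [1, 0]) (vector [1, 1]) w" if "cone_form (vector [1, 0]) (vector [1, 1]) w \<ge> 0"
  proof -
    have "b * (a - b) \<ge> 0" using that by (simp add: cone_form_def cross2_def ab algebra_simps)
    then consider "b = 0" | "b > 0" "a > b" | "b < 0" "a < b" | "b \<noteq> 0" "a = b"
      by (cases b "0::real" rule: linorder_cases; cases a b rule: linorder_cases) (auto simp: signs)
    then have "P > 0 \<and> (R > 0 \<or> R = 0 \<and> b = 0) \<or> P = 0 \<and> R > 0"
      using nz by cases (simp_all add: PR sq mult_neg_pos mult_pos_neg mult_neg_neg zero_le_mult_iff mult_le_0_iff)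
    then have "mother_value w = - 2 * b * (a - b)"
      unfolding val by (elim disjE conjE) simp_all
    then show ?thesis by (simp add: cone_form_def cross2_def ab algebra_simps)
  qed
  show "mother_value w = 2 * cone_form (vector [1, 1]) (vector [0, 1]) w" if "cone_form (vector [1, 1]) (vector [0, 1]) w \<ge> 0"
  proof -
    have "a * (b - a) \<ge> 0" using that by (simp add: cone_form_def cross2_def ab algebra_simps)
    then consider "a = 0" | "a > 0" "b > a" | "a < 0" "b < a" | "a \<noteq> 0" "b = a"
      by (cases a "0::real" rule: linorder_cases; cases b a rule: linorder_cases) (auto simp: signs)
    then have "P < 0 \<and> R \<ge> 0 \<or> P = 0 \<and> R > 0 \<and> a = b"
      using nz by cases (simp_all add: PR sq mult_neg_pos mult_pos_neg mult_neg_neg zero_le_mult_iff mult_le_0_iff)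
    then have "mother_value w = - 2 * a * (a - b)"
      unfolding val by (elim disjE conjE) simp_all
    then show ?thesis by (simp add: cone_form_def cross2_def ab algebra_simps)
  qed
  show "mother_value w = - 2 * cone_form (vector [0, 1]) (vector [-1, 1]) w" if "cone_form (vector [0, 1]) (vector [-1, 1]) w \<ge> 0"
  proof -
    have "a * (a + b) \<le> 0" using that by (simp add: cone_form_def cross2_def ab algebra_simps)
    then consider "a = 0" | "a > 0" "b < - a" | "a < 0" "b > - a" | "a \<noteq> 0" "b = - a"
      by (cases a "0::real" rule: linorder_cases; cases b "-a" rule: linorder_cases) (auto simp: signs)
    then have "P \<le> 0 \<and> R < 0 \<or> P < 0 \<and> R = 0 \<and> a = 0"
      using nz by cases (simp_all add: PR sq mult_neg_pos mult_pos_neg mult_neg_neg zero_le_mult_iff mult_le_0_iff)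
    then have "mother_value w = 2 * a * (a + b)"
      unfolding val by (elim disjE conjE) simp_all
    then show ?thesis by (simp add: cone_form_def cross2_def ab algebra_simps)
  qed
  show "mother_value w = 2 * cone_form (vector [-1, 1]) (vector [-1, 0]) w" if "cone_form (vector [-1, 1]) (vector [-1, 0]) w \<ge> 0"
  proof -
    have "b * (a + b) \<le> 0" using that by (simp add: cone_form_def cross2_def ab algebra_simps)
    then consider "b = 0" | "b > 0" "a < - b" | "b < 0" "a > - b" | "b \<noteq> 0" "a = - b"
      by (cases b "0::real" rule: linorder_cases; cases a "-b" rule: linorder_cases) (auto simp: signs)
    then have "P > 0 \<and> R \<le> 0 \<or> P = 0 \<and> R < 0 \<and> a = - b"
      using nz by cases (simp_all add: PR sq mult_neg_pos mult_pos_neg mult_neg_neg zero_le_mult_iff mult_le_0_iff)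
    then have "mother_value w = - 2 * b * (a + b)"
      unfolding val by (elim disjE conjE) simp_all
    then show ?thesis by (simp add: cone_form_def cross2_def ab algebra_simps)
  qed
qed

text \<open>The weights are those of the jumps at the ends \<open>p, q\<close> of an edge and at the vertices opposite to it.
By the parallelogram law this is zero for a quadratic form in place of \<open>mother_value\<close>.\<close>

definition value_defect :: "real^2 \<Rightarrow> real^2 \<Rightarrow> real" where
  "value_defect p q = 4 * mother_value p + 4 * mother_value q - 2 * mother_value (p + q) - 2 * mother_value (p - q)"

definition same_line_pair :: "real^2 \<Rightarrow> real^2 \<Rightarrow> real^2 \<Rightarrow> real^2 \<Rightarrow> bool" where
  "same_line_pair p q v v' \<longleftrightarrow> cross2 p v = 0 \<and> cross2 q v' = 0 \<or> cross2 p v' = 0 \<and> cross2 q v = 0"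

text \<open>The sign with which the edge \<open>p q\<close> occurs among the sides of the quadrilateral with vertices
\<open>corner_vectors\<close>, and zero if it is not a side.\<close>

definition side_sign :: "real^2 \<Rightarrow> real^2 \<Rightarrow> real" where
  "side_sign p q = of_bool (same_line_pair p q (vector [1, 0]) (vector [1, 1]))
     - of_bool (same_line_pair p q (vector [1, 1]) (vector [0, 1]))
     + of_bool (same_line_pair p q (vector [0, 1]) (vector [1, -1]))
     - of_bool (same_line_pair p q (vector [1, -1]) (vector [1, 0]))"

lemma value_defect_commute: "value_defect q p = value_defect p q"
  using mother_value_minus[of "p - q"] by (simp add: value_defect_def add.commute)

lemma value_defect_minus: "value_defect (- p) q = value_defect p q" "value_defect p (- q) = value_defect p q"
  using mother_value_minus[of p] mother_value_minus[of "p - q"] mother_value_minus[of "p + q"] mother_value_minus[of q] 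
  by (simp_all add: value_defect_def)

lemma side_sign_commute: "side_sign q p = side_sign p q"
  unfolding side_sign_def same_line_pair_def by (simp only: disj_commute conj_commute)

lemma side_sign_minus: "side_sign (- p) q = side_sign p q" "side_sign p (- q) = side_sign p q"
  by (simp_all add: side_sign_def same_line_pair_def cross2_linear)

text \<open>All four vectors are in one cone, where \<open>mother_value\<close> is a quadratic form. Such an edge is not a side
of the quadrilateral, since one of its ends is not a corner.\<close>

lemma value_defect_open_cone:
  assumes "lattice_basis p q"
    and "(v, v') \<in> quadrant_cones"
    and "cone_form v v' p > 0"
  shows "value_defect p q = 0" "side_sign p q = 0"
proof -
  have v: "lattice_basis v v'"
    using assms(2) by (auto simp: lattice_basis_def cross2_def forall_2)
  have "(\<forall>w. w \<noteq> 0 \<longrightarrow> cone_form v v' w \<ge> 0 \<longrightarrow> mother_value w = - 2 * cone_form v v' w) \<or>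
    (\<forall>w. w \<noteq> 0 \<longrightarrow> cone_form v v' w \<ge> 0 \<longrightarrow> mother_value w = 2 * cone_form v v' w)"
    using assms(2) mother_value_cone by (elim insertE emptyE; clarify; blast)
  then obtain k where k: "mother_value w = k * cone_form v v' w" if "w \<noteq> 0" "cone_form v v' w \<ge> 0" for w
    by blast
  have "p \<noteq> 0" "q \<noteq> 0" "p + q \<noteq> 0" "p - q \<noteq> 0"
    using assms(1) lattice_basis_nz[OF assms(1)] by (auto simp: lattice_basis_def cross2_linear add_eq_0_iff2)
  then have "value_defect p q = k * (4 * cone_form v v' p + 4 * cone_form v v' q - 2 * cone_form v v' (p + q) - 2 * cone_form v v' (p - q))"
    using k lattice_basis_in_cone[OF v assms(1,3)] assms(3) by (simp add: value_defect_def algebra_simps)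
  then show "value_defect p q = 0"
    by (simp only: cone_form_parallelogram mult_zero_right)
  have "cross2 p u \<noteq> 0" if "u \<in> corner_vectors" for u
    using assms(2,3) that by (auto simp: cone_form_def cross2_def mult_less_0_iff zero_less_mult_iff)
  then show "side_sign p q = 0"
    by (simp add: side_sign_def same_line_pair_def)
qed

lemma lattice_basis_on_line:
  assumes "lattice_basis p q" "\<forall>i. v$i \<in> \<int>" "cross2 p v = 0" "\<bar>v$1\<bar> = 1 \<or> \<bar>v$2\<bar> = 1"
  shows "p = v \<or> p = - v"
proof -
  have "\<exists>u. lattice_basis v u"
  proof (cases "\<bar>v$1\<bar> = 1")
    case True
    then show ?thesis using assms(2)
      by (intro exI[of _ "vector [0, 1]"]) (auto simp: lattice_basis_def cross2_def forall_2)
  next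
    case False
    then show ?thesis using assms(2,4)
      by (intro exI[of _ "vector [1, 0]"]) (auto simp: lattice_basis_def cross2_def forall_2)
  qed
  then obtain u where u: "lattice_basis v u" by blast
  have "circ p = circ v"
    using assms(3) lattice_basis_nz[OF assms(1)] lattice_basis_nz[OF u] by (simp add: circ_eq_iff)
  then have "v = p \<or> v = - p"
    by (rule lattice_basis_circ_eq[OF assms(1) u])
  then show ?thesis by auto
qed

lemma cone_or_line:
  assumes "lattice_basis p q"
  shows "(\<exists>(v, v') \<in> quadrant_cones. cone_form v v' p > 0)
    \<or> (\<exists>v \<in> corner_vectors. p = v \<or> p = - v)"
proof (rule disjCI)
  assume "\<not> (\<exists>v \<in> corner_vectors. p = v \<or> p = - v)"
  then have "\<forall>v \<in> corner_vectors. cross2 p v \<noteq> 0"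
    using lattice_basis_on_line[OF assms, of "vector [1, 0]"] lattice_basis_on_line[OF assms, of "vector [0, 1]"]
      lattice_basis_on_line[OF assms, of "vector [1, 1]"] lattice_basis_on_line[OF assms, of "vector [1, -1]"]
    by (simp add: forall_2) blast
  then have "p$1 \<noteq> 0" "p$2 \<noteq> 0" "p$1 \<noteq> p$2" "p$1 \<noteq> - p$2"
    by (auto simp: cross2_def)
  then show "\<exists>(v, v') \<in> quadrant_cones. cone_form v v' p > 0"
    by (auto simp: cone_form_def cross2_def zero_less_mult_iff)
qed

lemma mother_value_line:
  "mother_value (vector [1, 0]) = 0" "mother_value (vector [0, 1]) = 0"
  "mother_value (vector [1, 1]) = 0" "mother_value (vector [1, -1]) = 0"
  "mother_value (vector [2, 1]) = -2" "mother_value (vector [1, 2]) = 2"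
  "mother_value (vector [2, -1]) = 2" "mother_value (vector [1, -2]) = -2"
  by (simp_all add: mother_value_def mother_circ vector2_nz trace_2 matrix_matrix_nth2 parabolic_def sl2_e_def sl2_f_def sl2_h_def)

text \<open>By \<open>value_defect_open_cone\<close> only edges between corners remain. These are the four sides and the
diagonal through \<open>(1, 0)\<close> and \<open>(0, 1)\<close>, since the other two corners have determinant \<open>-2\<close>.\<close>

lemma value_defect_eq_side_sign:
  assumes "lattice_basis p q"
  shows "value_defect p q = 4 * side_sign p q"
proof -
  have qp: "lattice_basis q p" using assms lattice_basis_commute by blast
  consider "value_defect p q = 0 \<and> side_sign p q = 0" |
    v v' where "v \<in> corner_vectors" "v' \<in> corner_vectors" "p = v \<or> p = - v" "q = v' \<or> q = - v'"
    using cone_or_line[OF assms] cone_or_line[OF qp] value_defect_open_cone[OF assms] value_defect_open_cone[OF qp]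
      value_defect_commute[of p q] side_sign_commute[of p q]
    by (smt (verit) case_prodE)
  then show ?thesis
  proof cases
    case (2 v v')
    then have *: "value_defect p q = value_defect v v'" "side_sign p q = side_sign v v'"
      by (auto simp: value_defect_minus side_sign_minus)
    have "\<bar>cross2 v v'\<bar> = 1"
      using assms 2 by (auto simp: lattice_basis_def cross2_linear)
    moreover have vec: "vector [a, b] + vector [c, d] = (vector [a + c, b + d] :: real^2)"
       "vector [a, b] - vector [c, d] = (vector [a - c, b - d] :: real^2)"
       "vector [-a, -b] = - (vector [a, b] :: real^2)" for a b c d
      by (simp_all add: vec2_eq_iff)
    have "mother_value (vector [-1, b]) = mother_value (vector [1, -b])"
      "mother_value (vector [0, -1]) = mother_value (vector [0, 1])" for b
      using mother_value_minus[of "vector [1, -b]"] mother_value_minus[of "vector [0, 1]"] vec(3)[of 1 "-b"] vec(3)[of 0 1]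
      by simp_all
    ultimately have "value_defect v v' = 4 * side_sign v v'"
      using 2(1,2) by (elim insertE emptyE; simp add: value_defect_def side_sign_def same_line_pair_def cross2_def vec(1,2) mother_value_line)
    then show ?thesis using * by simp
  qed simp
qed

abbreviation corners :: "real^2^2 \<Rightarrow> complex set" where
  "corners A \<equiv> {edge_frame A 1 0, edge_frame A 0 1, edge_frame A 1 1, edge_frame A 1 (-1)}"

lemma cross2_matrix_inv:
  assumes "A \<in> SL2Z"
  shows "cross2 (A *v w) v = cross2 w (matrix_inv A *v v)"
proof -
  have "cross2 (A *v w) (A *v (matrix_inv A *v v)) = cross2 w (matrix_inv A *v v)"
    unfolding cross2_matrix det_SL2Z[OF assms] by simp
  then show ?thesis
    using matrix_inv_vector_mult[OF assms] by simp
qed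

lemma circ_eq_frame_iff:
  assumes "A \<in> SL2Z" "w \<noteq> 0" "x \<noteq> 0 \<or> y \<noteq> 0"
  shows "circ w = edge_frame A x y \<longleftrightarrow> cross2 (A *v w) (vector [x, y]) = 0"
  using assms by (simp add: circ_eq_iff cross2_matrix_inv SL2Z_vector_nz matrix_inv_in_SL2Z vector2_nz)

lemma wavelet_jump_outside_corners:
  assumes "A \<in> SL2Z" "z \<in> circle" "z \<notin> corners A"
  shows "wavelet_jump A z = 0"
proof -
  obtain w where w: "w \<noteq> 0" "z = circ w"
    using circle_circ_cases[OF assms(2)] .
  have "step_weight (A *v w) = 0"
    using assms(3) unfolding w(2)
    by (auto simp: circ_eq_frame_iff[OF assms(1) w(1)] step_weight_def cross2_def abs_eq_iff)
  then show ?thesis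
    by (simp add: w wavelet_jump_circ)
qed

lemma wavelet_jump_corner:
  assumes "A \<in> SL2Z" "x \<noteq> 0 \<or> y \<noteq> 0"
  shows "wavelet_jump A (edge_frame A x y) =
    step_weight (vector [x, y]) *\<^sub>R parabolic (matrix_inv A *v vector [x, y])"
  using assms by (simp add: wavelet_jump_circ SL2Z_vector_nz matrix_inv_in_SL2Z vector2_nz matrix_inv_vector_mult)

lemma sum_corners:
  fixes h :: "complex \<Rightarrow> real"
  assumes "A \<in> SL2Z"
  shows "sum h (corners A) = h (edge_frame A 1 0) + h (edge_frame A 0 1) + h (edge_frame A 1 1) + h (edge_frame A 1 (-1))"
  using assms by (simp add: frame_eq_iff)

text \<open>By equivariance the first wavelet may be replaced by the mother wavelet. The constant \<open>X\<close> drops out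
because the jumps of the second wavelet add up to zero, by the parallelogram law.\<close>

lemma pairing_eq_value_defect:
  assumes "A \<in> SL2Z" "B \<in> SL2Z"
  shows "(\<Sum>z\<in>corners B. trace ((wavelet A z - X) ** wavelet_jump B z)) =
    value_defect (A *v (matrix_inv B *v vector [1, 0])) (A *v (matrix_inv B *v vector [0, 1]))"
proof -
  let ?p = "matrix_inv B *v vector [1, 0]" and ?q = "matrix_inv B *v vector [0, 1]"
  have pq: "matrix_inv B *v vector [1, 1] = ?p + ?q" "matrix_inv B *v vector [1, -1] = ?p - ?q"
    by (simp_all add: vec2_eq_iff matrix_vector_nth2)
  have w: "step_weight (vector [1, 0]) = 4" "step_weight (vector [0, 1]) = 4"
     "step_weight (vector [1, 1]) = - 2" "step_weight (vector [1, -1]) = - 2"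
    by (simp_all add: step_weight_def)
  have nz: "matrix_inv B *v vector [x, y] \<noteq> 0" if "x \<noteq> 0 \<or> y \<noteq> 0" for x y
    using that assms(2) by (simp add: SL2Z_vector_nz matrix_inv_in_SL2Z vector2_nz)
  have t: "trace ((wavelet A (edge_frame B x y) - X) ** wavelet_jump B (edge_frame B x y)) =
     step_weight (vector [x, y]) * (mother_value (A *v (matrix_inv B *v vector [x, y]))
       - trace (X ** parabolic (matrix_inv B *v vector [x, y])))" if "x \<noteq> 0 \<or> y \<noteq> 0" for x y
    using wavelet_value[OF assms(1) nz[OF that]]
    by (simp add: wavelet_jump_corner[OF assms(2) that] trace_add_mult)
  have "trace (X ** (4 *\<^sub>R parabolic ?p + 4 *\<^sub>R parabolic ?q - 2 *\<^sub>R parabolic (?p + ?q) - 2 *\<^sub>R parabolic (?p - ?q))) = 0"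
    unfolding parabolic_parallelogram by (simp add: trace_2)
  then have "4 * trace (X ** parabolic ?p) + 4 * trace (X ** parabolic ?q) - 2 * trace (X ** parabolic (?p + ?q)) - 2 * trace (X ** parabolic (?p - ?q)) = 0"
    by (simp only: trace_add_mult)
  moreover note t[of 1 0, OF disjI1[OF one_neq_zero]] t[of 0 1, OF disjI2[OF one_neq_zero]]
    t[of 1 1, OF disjI1[OF one_neq_zero]] t[of 1 "-1", OF disjI1[OF one_neq_zero]]
  ultimately show ?thesis
    unfolding sum_corners[OF assms(2)] unfolding w pq
    by (simp add: value_defect_def matrix_vector_right_distrib matrix_vector_mult_diff_distrib algebra_simps)
qed

text \<open>The alternating sum over the sides of the quadrilateral around the edge of \<open>A\<close>.\<close>

definition neighbour_sum :: "tangent \<Rightarrow> real^2^2 \<Rightarrow> real" where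
  "neighbour_sum v A = v (geodesic (edge_frame A 1 0) (edge_frame A 1 1))
     - v (geodesic (edge_frame A 1 1) (edge_frame A 0 1))
     + v (geodesic (edge_frame A 0 1) (edge_frame A 1 (-1)))
     - v (geodesic (edge_frame A 1 (-1)) (edge_frame A 1 0))"

lemma pairing_eq_neighbour_sum:
  assumes "A \<in> SL2Z" "B \<in> SL2Z"
  shows "(\<Sum>z\<in>corners B. trace ((wavelet A z - X) ** wavelet_jump B z)) =
    4 * neighbour_sum (\<lambda>e. of_bool (edge B = e)) A"
proof -
  let ?p = "matrix_inv B *v vector [1, 0]" and ?q = "matrix_inv B *v vector [0, 1]"
  have basis: "lattice_basis ?p ?q"
    using assms(2) by (simp add: frame_lattice_basis)
  have nz: "?p \<noteq> 0" "?q \<noteq> 0" using lattice_basis_nz[OF basis] by auto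
  have "lattice_basis (A *v ?p) (A *v ?q)"
  proof -
    have "(A *v w) $ i \<in> \<int>" if "\<forall>i. w $ i \<in> \<int>" for w i
      using assms(1) that by (auto simp: SL2Z_def matrix_vector_mult_def sum_2)
    then show ?thesis
      using basis by (auto simp: lattice_basis_def cross2_matrix det_SL2Z[OF assms(1)])
  qed
  moreover have "same_line_pair (A *v ?p) (A *v ?q) (vector [x, y]) (vector [x', y']) \<longleftrightarrow>
     edge B = geodesic (edge_frame A x y) (edge_frame A x' y')"
    if "x \<noteq> 0 \<or> y \<noteq> 0" "x' \<noteq> 0 \<or> y' \<noteq> 0" "x * y' \<noteq> y * x'" for x y x' y'
  proof -
    have "edge_frame B 1 0 \<noteq> edge_frame B 0 1" "edge_frame A x y \<noteq> edge_frame A x' y'"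
      using assms that by (simp_all add: frame_eq_iff)
    then have "edge B = geodesic (edge_frame A x y) (edge_frame A x' y') \<longleftrightarrow>
       {circ ?p, circ ?q} = {edge_frame A x y, edge_frame A x' y'}"
      unfolding edge_eq_frame[OF assms(2)] using assms that
      by (subst geodesic_eq_iff) (simp_all add: norm_frame)
    then show ?thesis
      using that nz by (auto simp: same_line_pair_def doubleton_eq_iff circ_eq_frame_iff[OF assms(1)])
  qed
  ultimately show ?thesis
    unfolding pairing_eq_value_defect[OF assms] value_defect_eq_side_sign[OF \<open>lattice_basis (A *v ?p) (A *v ?q)\<close>]
    by (simp add: side_sign_def neighbour_sum_def)
qed

section \<open>Comparison of the two forms\<close>

definition frame_of :: "complex set \<Rightarrow> real^2^2" where
  "frame_of e = (SOME A. A \<in> SL2Z \<and> edge A = e)"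

lemma frame_of:
  assumes "e \<in> farey"
  shows "frame_of e \<in> SL2Z" "edge (frame_of e) = e"
proof -
  have "\<exists>A. A \<in> SL2Z \<and> edge A = e" using assms by (auto simp: farey_def)
  then have "frame_of e \<in> SL2Z \<and> edge (frame_of e) = e"
    unfolding frame_of_def by (rule someI_ex)
  then show "frame_of e \<in> SL2Z" "edge (frame_of e) = e" by auto
qed

lemma edge_wavelet_eq: "edge_wavelet e z = wavelet (frame_of e) z - normalizer (frame_of e)"
  by (simp add: edge_wavelet_def normalized_wavelet_def frame_of_def)

definition tangent_jump :: "tangent \<Rightarrow> complex \<Rightarrow> real^2^2" where
  "tangent_jump u z = (\<Sum>e\<in>{e. u e \<noteq> 0}. u e *\<^sub>R wavelet_jump (frame_of e) z)"

lemma tangent_field_one_sided: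
  assumes "finite {e. u e \<noteq> 0}" "{e. u e \<noteq> 0} \<subseteq> farey" "z \<in> circle"
  shows "value_beyond (tangent_field u) z = tangent_field u z"
    and "value_before (tangent_field u) z = tangent_field u z - tangent_jump u z"
proof -
  let ?S = "{e. u e \<noteq> 0}" and ?s = "Arg z"
  have z: "cis ?s = z"
    using assms(3) cis_Arg[of z] by (force simp: sgn_eq)
  have "\<forall>\<^sub>F t in at_right ?s. \<forall>e\<in>?S. wavelet (frame_of e) (cis t) = wavelet (frame_of e) (cis ?s)"
    using assms wavelet_one_sided(1) frame_of(1) by (intro eventually_ball_finite) blast+
  then have "\<forall>\<^sub>F t in at_right ?s. tangent_field u (cis t) = tangent_field u z"
    by eventually_elim (simp add: tangent_field_def edge_wavelet_eq z)
  then show "value_beyond (tangent_field u) z = tangent_field u z"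
    unfolding value_beyond_def by (intro tendsto_Lim tendsto_eventually) simp_all
  have "\<forall>\<^sub>F t in at_left ?s. \<forall>e\<in>?S. wavelet (frame_of e) (cis t) =
      wavelet (frame_of e) (cis ?s) - wavelet_jump (frame_of e) (cis ?s)"
    using assms wavelet_one_sided(2) frame_of(1) by (intro eventually_ball_finite) blast+
  then have "\<forall>\<^sub>F t in at_left ?s. tangent_field u (cis t) = tangent_field u z - tangent_jump u z"
    by eventually_elim
      (auto simp: tangent_field_def edge_wavelet_eq z tangent_jump_def scaleR_diff_right
        simp flip: sum_subtractf intro!: sum.cong)
  then show "value_before (tangent_field u) z = tangent_field u z - tangent_jump u z"
    unfolding value_before_def by (intro tendsto_Lim tendsto_eventually) simp_all
qed

text \<open>All jumps at a given point are multiples of the same nilpotent matrix. This is why the mean of the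
two one-sided values in the cocycle may be replaced by either of them.\<close>

lemma trace_tangent_jump:
  "trace (tangent_jump u z ** tangent_jump v z) = 0"
proof -
  let ?w = "half_angle (Arg z)"
  have "\<exists>k. tangent_jump u z = k *\<^sub>R parabolic ?w" for u
    by (intro exI[of _ "\<Sum>e\<in>{e. u e \<noteq> 0}. u e * step_weight (frame_of e *v ?w)"])
       (simp add: tangent_jump_def wavelet_jump_def scaleR_left.sum)
  then obtain k l where "tangent_jump u z = k *\<^sub>R parabolic ?w" "tangent_jump v z = l *\<^sub>R parabolic ?w"
    by metis
  then show ?thesis
    by (simp add: trace_add_mult trace_parabolic_parabolic)
qed

text \<open>The double sum over breakpoints and pairs of edges is rearranged so that the pairings of single
wavelets can be inserted.\<close>

lemma cocycle_tangent_field: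
  assumes u: "finite {e. u e \<noteq> 0}" "{e. u e \<noteq> 0} \<subseteq> farey"
    and v: "finite {e. v e \<noteq> 0}" "{e. v e \<noteq> 0} \<subseteq> farey"
  shows "cocycle (tangent_field u) (tangent_field v) =
    (\<Sum>e\<in>{e. u e \<noteq> 0}. u e * (4 * neighbour_sum v (frame_of e)))"
proof -
  let ?U = "{e. u e \<noteq> 0}" and ?V = "{e. v e \<noteq> 0}"
  define F where "F = (\<Union>f\<in>?V. corners (frame_of f))"
  have F: "finite F" "F \<subseteq> circle"
    using v frame_of(1) by (auto simp: F_def norm_frame subset_iff)
  have outside: "tangent_jump v z = 0" if "z \<in> circle - F" for z
    unfolding tangent_jump_def
    by (rule sum.neutral) (use that v frame_of(1) wavelet_jump_outside_corners in \<open>fastforce simp: F_def\<close>)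
  have bp: "breakpoints (tangent_field v) = {z \<in> circle. tangent_jump v z \<noteq> 0}"
    unfolding breakpoints_def using tangent_field_one_sided[OF v] by auto
  have "cocycle (tangent_field u) (tangent_field v) =
     (\<Sum>z\<in>breakpoints (tangent_field v). trace (tangent_field u z ** tangent_jump v z))"
  proof -
    have expand: "trace ((X + (X - J)) ** K) = 2 * trace (X ** K) - trace (J ** K)" for X J K :: "real^2^2"
      by (simp only: trace_add_mult)
    have "trace ((value_beyond (tangent_field u) z + value_before (tangent_field u) z) **
         (value_beyond (tangent_field v) z - value_before (tangent_field v) z)) =
       2 * trace (tangent_field u z ** tangent_jump v z)" if "z \<in> circle" for z
      using that trace_tangent_jump[of u z v]
      unfolding tangent_field_one_sided[OF u that] tangent_field_one_sided[OF v that] expand by simp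
    then show ?thesis
      unfolding cocycle_def by (simp add: bp sum_distrib_left)
  qed
  also have "\<dots> = (\<Sum>z\<in>F. trace (tangent_field u z ** tangent_jump v z))"
    using F outside unfolding bp by (intro sum.mono_neutral_left) (auto simp: trace_2)
  also have "\<dots> = (\<Sum>z\<in>F. \<Sum>f\<in>?V. \<Sum>e\<in>?U. u e * v f * trace (edge_wavelet e z ** wavelet_jump (frame_of f) z))"
    by (simp add: tangent_field_def tangent_jump_def trace_sum_mult trace_add_mult sum_distrib_left mult_ac)
  also have "\<dots> = (\<Sum>f\<in>?V. \<Sum>z\<in>F. \<Sum>e\<in>?U. u e * v f * trace (edge_wavelet e z ** wavelet_jump (frame_of f) z))"
    by (rule sum.swap)
  also have "\<dots> = (\<Sum>f\<in>?V. \<Sum>e\<in>?U. \<Sum>z\<in>F. u e * v f * trace (edge_wavelet e z ** wavelet_jump (frame_of f) z))"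
    by (intro sum.cong refl sum.swap)
  also have "\<dots> = (\<Sum>f\<in>?V. \<Sum>e\<in>?U. u e * v f * (4 * neighbour_sum (\<lambda>e. of_bool (f = e)) (frame_of e)))"
  proof (intro sum.cong refl)
    fix e f assume ef: "f \<in> ?V" "e \<in> ?U"
    then have fr: "frame_of e \<in> SL2Z" "frame_of f \<in> SL2Z" "edge (frame_of f) = f"
      using u(2) v(2) frame_of by blast+
    have "(\<Sum>z\<in>F. u e * v f * trace (edge_wavelet e z ** wavelet_jump (frame_of f) z)) =
       u e * v f * (\<Sum>z\<in>corners (frame_of f). trace (edge_wavelet e z ** wavelet_jump (frame_of f) z))"
      unfolding sum_distrib_left
      by (rule sum.mono_neutral_right)
         (use F ef wavelet_jump_outside_corners[OF fr(2)] in \<open>auto simp: F_def trace_2 subset_iff\<close>)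
    then show "(\<Sum>z\<in>F. u e * v f * trace (edge_wavelet e z ** wavelet_jump (frame_of f) z)) =
       u e * v f * (4 * neighbour_sum (\<lambda>e. of_bool (f = e)) (frame_of e))"
      unfolding edge_wavelet_eq pairing_eq_neighbour_sum[OF fr(1,2)] fr(3) .
  qed
  also have "\<dots> = (\<Sum>e\<in>?U. \<Sum>f\<in>?V. u e * v f * (4 * neighbour_sum (\<lambda>e. of_bool (f = e)) (frame_of e)))"
    by (rule sum.swap)
  also have "\<dots> = (\<Sum>e\<in>?U. u e * (4 * neighbour_sum v (frame_of e)))"
  proof (intro sum.cong refl)
    fix e
    have delta: "(\<Sum>f\<in>?V. v f * of_bool (f = n)) = v n" for n
      using v(1) by (simp add: of_bool_def if_distrib sum.delta cong: if_cong)
    have "(\<Sum>f\<in>?V. v f * neighbour_sum (\<lambda>e. of_bool (f = e)) A) = neighbour_sum v A" for A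
      by (simp only: neighbour_sum_def distrib_left right_diff_distrib sum.distrib sum_subtractf delta)
    moreover have "(\<Sum>f\<in>?V. u e * v f * (4 * neighbour_sum (\<lambda>e. of_bool (f = e)) (frame_of e))) =
       u e * (4 * (\<Sum>f\<in>?V. v f * neighbour_sum (\<lambda>e. of_bool (f = e)) (frame_of e)))"
      by (simp add: sum_distrib_left mult_ac)
    ultimately show "(\<Sum>f\<in>?V. u e * v f * (4 * neighbour_sum (\<lambda>e. of_bool (f = e)) (frame_of e))) =
      u e * (4 * neighbour_sum v (frame_of e))" by simp
  qed
  finally show ?thesis .
qed

text \<open>The coefficient of \<open>u e\<close> in twice the summand of \<open>\<omega>\<close> for a triangle with clockwise edges \<open>a, b, c\<close>:
the following edge minus the preceding one.\<close>

definition turn :: "tangent \<Rightarrow> complex set \<times> complex set \<times> complex set \<Rightarrow> complex set \<Rightarrow> real" where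
  "turn v = (\<lambda>(a, b, c) e. of_bool (e = a) * (v b - v c) + of_bool (e = b) * (v c - v a) + of_bool (e = c) * (v a - v b))"

lemma turn_clockwise_edges:
  assumes "has_clockwise_edges T (e, b, c)"
  shows "turn v (clockwise_edges T) e = v b - v c"
proof -
  have "clockwise_edges T \<in> {(e, b, c), (b, c, e), (c, e, b)}"
    using assms has_clockwise_edges_clockwise_edges has_clockwise_edges_unique by blast
  then show ?thesis
    using has_clockwise_edges_distinct[OF assms] by (elim insertE emptyE) (simp_all add: turn_def)
qed

text \<open>Only the two triangles adjacent to the edge contribute.\<close>

lemma turn_has_sum:
  assumes "A \<in> SL2Z"
  shows "((\<lambda>T. turn v (clockwise_edges T) (edge A)) has_sum neighbour_sum v A) farey_triangles"
proof (rule has_sum_finite_neutralI)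
  let ?B = "{triangle_at A 1, triangle_at A (-1)}"
  show "finite ?B" "?B \<subseteq> farey_triangles"
    using triangle_at_in_farey_triangles[OF assms] by auto
  show "turn v (clockwise_edges T) (edge A) = 0" if T: "T \<in> farey_triangles - ?B" for T
  proof (rule ccontr)
    assume *: "turn v (clockwise_edges T) (edge A) \<noteq> 0"
    obtain a b c where abc: "clockwise_edges T = (a, b, c)"
      by (metis prod_cases3)
    moreover obtain abc' where "has_clockwise_edges T abc'"
      using T by (auto simp: farey_triangles_def)
    ultimately have cw: "has_clockwise_edges T (a, b, c)"
      using has_clockwise_edges_clockwise_edges by metis
    have "edge A \<in> {a, b, c}"
      by (rule ccontr) (use * abc in \<open>simp add: turn_def\<close>)
    then have "\<exists>b c. has_clockwise_edges T (edge A, b, c)"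
      using cw has_clockwise_edges_rotate by (metis insertE singletonD)
    then show False
      using farey_triangle_at_edge[OF assms] T by blast
  qed
  show "neighbour_sum v A = (\<Sum>T\<in>?B. turn v (clockwise_edges T) (edge A))"
    using triangle_at_distinct[OF assms] turn_clockwise_edges[OF triangle_at_clockwise_edges(1)[OF assms]]
      turn_clockwise_edges[OF triangle_at_clockwise_edges(2)[OF assms]]
    by (simp add: neighbour_sum_def)
qed

lemma has_sum_sum:
  fixes f :: "'a \<Rightarrow> 'b \<Rightarrow> real"
  assumes "\<And>i. i \<in> I \<Longrightarrow> (f i has_sum s i) A"
  shows "((\<lambda>x. \<Sum>i\<in>I. f i x) has_sum (\<Sum>i\<in>I. s i)) A"
  using assms by (induction I rule: infinite_finite_induct) (auto intro!: has_sum_add has_sum_0)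

text \<open>The summand of each triangle is a finite sum over the edges in the support of \<open>u\<close>, and the sum over
the triangles is evaluated separately for each of these edges.\<close>

lemma wp_form_eq:
  assumes "finite {e. u e \<noteq> 0}" "{e. u e \<noteq> 0} \<subseteq> farey"
  shows "wp_form u v = - (\<Sum>e\<in>{e. u e \<noteq> 0}. u e * neighbour_sum v (frame_of e))"
proof -
  let ?U = "{e. u e \<noteq> 0}"
  have summand: "(case t of (a, b, c) \<Rightarrow> wedge (dlog a) (dlog b) u v + wedge (dlog b) (dlog c) u v
                  + wedge (dlog c) (dlog a) u v) = (1/2) * (\<Sum>e\<in>?U. u e * turn v t e)" for t
  proof -
    obtain a b c where t: "t = (a, b, c)" by (metis prod_cases3)
    have delta: "(\<Sum>e\<in>?U. u e * (of_bool (e = n) * k)) = u n * k" for n k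
      using assms(1) by (simp add: of_bool_def if_distrib sum.delta if_distribR cong: if_cong)
    have "(\<Sum>e\<in>?U. u e * turn v t e) = u a * (v b - v c) + u b * (v c - v a) + u c * (v a - v b)"
      by (simp only: t turn_def split distrib_left sum.distrib delta)
    then show ?thesis
      by (simp add: t wedge_def dlog_def field_simps)
  qed
  have "((\<lambda>T. turn v (clockwise_edges T) e) has_sum neighbour_sum v (frame_of e)) farey_triangles" if "e \<in> ?U" for e
    using turn_has_sum[of "frame_of e" v] frame_of[of e] that assms(2) by auto
  then have "((\<lambda>T. (1/2) * (\<Sum>e\<in>?U. u e * turn v (clockwise_edges T) e)) has_sum
     (1/2) * (\<Sum>e\<in>?U. u e * neighbour_sum v (frame_of e))) farey_triangles"
    by (intro has_sum_cmult_right has_sum_sum)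
  then show ?thesis
    unfolding wp_form_def summand using infsumI by fastforce
qed

theorem theorem6p2:
  fixes u v :: tangent
  assumes "finite {e. u e \<noteq> 0}" and "{e. u e \<noteq> 0} \<subseteq> farey"
    and "finite {e. v e \<noteq> 0}" and "{e. v e \<noteq> 0} \<subseteq> farey"
  shows "cocycle (tangent_field u) (tangent_field v) = - 4 * wp_form u v"
  unfolding cocycle_tangent_field[OF assms] wp_form_eq[OF assms(1,2)]
  by (simp add: sum_distrib_left sum_negf mult_ac)

end
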